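(* Let $Q(\xi)=1/(1+\xi^2)$. There are absolute constants $C>0$ and $K>0$ such that for all $N\geq 1$ and $x\geq 2$, $$ \mathbb{P}\big(\langle Q,\, \mathcal{E}_N\rangle \geq x\big) \leq K e^{-C x\log x}, $$ where the probability is with respect to Haar probability measure on $U(N)$.
   Context: Let $g\in U(N)$ be Haar-distributed, with eigenvalues $e^{2\pi i\theta_1},\dots,e^{2\pi i\theta_N}$, $\theta_j\in[-1/2,1/2)$. For a function $\eta$ define $\langle \eta,\mathcal{E}_N(g)\rangle:=\lim_{V\to\infty}\sum_{j=1}^N\sum_{\nu=-V}^V\eta\big(N(\theta_j+\nu)\big)$, and write $\langle\eta,\mathcal{E}_N\rangle$ for this random variable. *)

theory Defs
  imports
    "HOL-Probability.Probability"
    "Jordan_Normal_Form.Schur_Decomposition"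
    "Jordan_Normal_Form.Char_Poly"
begin

definition unitary_group :: "nat \<Rightarrow> complex mat set" where
  "unitary_group N = {g \<in> carrier_mat N N. g * mat_adjoint g = 1\<^sub>m N \<and> mat_adjoint g * g = 1\<^sub>m N}"

text \<open>The type of matrices carries no topology. The Borel \<open>\<sigma>\<close>-algebra of \<open>U(N)\<close>, as a subspace
  of the \<open>N \<times> N\<close> complex matrices, is the trace of the product \<open>\<sigma>\<close>-algebra along the matrix entries.\<close>

definition unitary_borel :: "nat \<Rightarrow> complex mat measure" where
  "unitary_borel N = vimage_algebra (unitary_group N)
     (\<lambda>g. \<lambda>ij \<in> {..<N} \<times> {..<N}. g $$ ij)
     (\<Pi>\<^sub>M ij \<in> {..<N} \<times> {..<N}. (borel :: complex measure))"

definition haar_prob :: "nat \<Rightarrow> complex mat measure \<Rightarrow> bool" where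
  "haar_prob N M \<longleftrightarrow> prob_space M \<and> sets M = sets (unitary_borel N) \<and>
     (\<forall>u \<in> unitary_group N. \<forall>S \<in> sets M. emeasure M ((\<lambda>g. u * g) ` S) = emeasure M S)"

definition eigenangle :: "complex \<Rightarrow> real" where
  "eigenangle z = (THE \<theta>. -1/2 \<le> \<theta> \<and> \<theta> < 1/2 \<and> cis (2 * pi * \<theta>) = z)"

text \<open>Eigenvalues are listed with algebraic multiplicity.\<close>

definition eigenangles :: "complex mat \<Rightarrow> real multiset" where
  "eigenangles g = image_mset eigenangle (proots (char_poly g))"

definition linear_stat :: "nat \<Rightarrow> (real \<Rightarrow> real) \<Rightarrow> complex mat \<Rightarrow> real" where
  "linear_stat N \<eta> g =
     lim (\<lambda>V. \<Sum>\<theta> \<in># eigenangles g. \<Sum>\<nu> = - int V..int V. \<eta> (real N * (\<theta> + real_of_int \<nu>)))"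

lemma space_haar_prob: "haar_prob N M \<Longrightarrow> space M = unitary_group N"
  by (auto simp: haar_prob_def unitary_borel_def dest: sets_eq_imp_space_eq)

lemma eigenangle_ex1:
  assumes "norm z = 1"
  shows "\<exists>!\<theta>. -1/2 \<le> \<theta> \<and> \<theta> < 1/2 \<and> cis (2 * pi * \<theta>) = z"
proof (rule ex_ex1I)
  define t where "t = Arg z / (2 * pi)"
  have t: "-1/2 < t" "t \<le> 1/2" "cis (2 * pi * t) = z"
    using Arg_bounded[of z] rcis_cmod_Arg[of z] assms
    by (simp_all add: t_def divide_simps rcis_def)
  show "\<exists>\<theta>. -1/2 \<le> \<theta> \<and> \<theta> < 1/2 \<and> cis (2 * pi * \<theta>) = z"
  proof (cases "t = 1/2")
    case True
    have "z = - 1"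
      using t(3) unfolding True by simp
    then have "cis (2 * pi * (-1/2)) = z"
      by (simp add: complex_eq_iff)
    then show ?thesis by (intro exI[of _ "-1/2"] conjI) simp_all
  next
    case False
    then show ?thesis using t by (intro exI[of _ t] conjI) simp_all
  qed
next
  fix a b :: real
  assume a: "-1/2 \<le> a \<and> a < 1/2 \<and> cis (2 * pi * a) = z"
    and b: "-1/2 \<le> b \<and> b < 1/2 \<and> cis (2 * pi * b) = z"
  then have "cis (2 * pi * a) / cis (2 * pi * b) = 1"
    using cis_neq_zero[of "2 * pi * b"] by (metis divide_self)
  then have "cis (2 * pi * (a - b)) = 1"
    by (simp only: cis_divide right_diff_distrib)
  then have "cos (2 * pi * (a - b)) = 1"
    by (simp add: complex_eq_iff)
  then obtain k :: int where "2 * pi * (a - b) = of_int k * 2 * pi"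
    unfolding cos_one_2pi_int by blast
  then have "a - b = of_int k" by simp
  moreover have "\<bar>a - b\<bar> < 1" using a b by linarith
  ultimately have "k = 0" by linarith
  with \<open>a - b = of_int k\<close> show "a = b" by simp
qed

end

theory Submission
  imports Defs
begin

text \<open>
  Put \<open>\<gamma> = 1 - 1/(2N)\<close> and \<open>Y = 1 - \<gamma>g\<close>. Up to an absolute constant the linear statistic is at most
  \<open>\<Sum>\<^sub>j f\<^sub>j\<close> with \<open>f\<^sub>j = 1 / (4 N\<^sup>2 |1 - \<gamma>\<lambda>\<^sub>j|\<^sup>2) \<le> 1\<close>, and \<open>1 + x f\<^sub>j \<ge> (1 + x) powr f\<^sub>j\<close>, so by Markov's
  inequality it suffices to show that the expectation of \<open>\<Prod>\<^sub>j (1 + x f\<^sub>j)\<close> is at most \<open>exp x\<close>.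

  This product equals \<open>det (b + Y Y\<^sup>*) / det (Y Y\<^sup>*)\<close> with \<open>b = x / (4 N\<^sup>2)\<close>, which expands into
  \<open>\<Sum>\<^sub>J b\<^bsup>N - |J|\<^esup> G\<^sub>J / G\<close>, where \<open>G\<^sub>J\<close> is the Gram determinant of the rows of \<open>Y\<close> with index in \<open>J\<close>
  and \<open>G\<close> that of all rows. Multiplying row \<open>i\<close> of \<open>g\<close> by a phase preserves Haar measure and changes only
  row \<open>i\<close> of \<open>Y\<close>. For \<open>i \<notin> J\<close> the average of \<open>G\<^sub>J / G\<^bsub>insert i J\<^esub>\<close> over such phases is at most a constant multiple
  of \<open>1 / (1 - \<gamma>\<^sup>2)\<close>: the ratio is at most \<open>1 / |v\<^sub>i - w z|\<^sup>2\<close> for the phase \<open>w\<close> and suitable \<open>v\<close>, \<open>z\<close> not depending on \<open>w\<close> with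
  \<open>|v\<^sub>i|\<^sup>2 - |z|\<^sup>2 \<ge> 1 - \<gamma>\<^sup>2\<close>. Telescoping bounds the expectation of \<open>G\<^sub>J / G\<close> by
  \<open>(4N)\<^bsup>N - |J|\<^esup>\<close>. Averaging over roots of unity instead of the circle costs only a constant and avoids
  an application of Fubini's theorem.
\<close>

section \<open>Principal minors of Gram matrices\<close>

definition gram :: "nat \<Rightarrow> (nat \<Rightarrow> nat \<Rightarrow> complex) \<Rightarrow> nat \<Rightarrow> nat \<Rightarrow> complex" where
  "gram n Y i j = (\<Sum>k=0..<n. Y i k * cnj (Y j k))"

text \<open>Replacing the rows outside \<open>J\<close> by unit rows keeps the size \<open>n\<close> while the determinant becomes the
  principal minor on \<open>J\<close>.\<close>

definition minor_mat :: "nat \<Rightarrow> nat set \<Rightarrow> (nat \<Rightarrow> nat \<Rightarrow> complex) \<Rightarrow> complex mat" where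
  "minor_mat n J H = mat n n (\<lambda>(i, j). if i \<in> J then H i j else if i = j then 1 else 0)"

definition principal_minor :: "nat \<Rightarrow> nat set \<Rightarrow> (nat \<Rightarrow> nat \<Rightarrow> complex) \<Rightarrow> complex" where
  "principal_minor n J H = det (minor_mat n J H)"

lemma minor_mat_carrier [simp]: "minor_mat n J H \<in> carrier_mat n n"
  by (simp add: minor_mat_def)

lemma principal_minor_leibniz:
  "principal_minor n J H = (\<Sum>p | p permutes {0..<n}.
     signof p * (\<Prod>i=0..<n. if i \<in> J then H i (p i) else if i = p i then 1 else 0))"
  unfolding principal_minor_def det_def'[OF minor_mat_carrier]
  by (intro sum.cong refl arg_cong2[where f = "(*)"] prod.cong)
    (auto simp: minor_mat_def permutes_in_image)

text \<open>In each Leibniz product every row contributes either its entry of \<open>H\<close> or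
  the diagonal \<open>b\<close>. The set \<open>J\<close> collects the rows of the first kind; every
  other row contributes \<open>b\<close> times a unit row, whence the exponent
  \<open>n - card J\<close>.\<close>

lemma det_add_diag_expand:
  fixes b :: complex
  shows "det (mat n n (\<lambda>(i, j). H i j + (if i = j then b else 0))) =
    (\<Sum>J\<in>Pow {0..<n}. b ^ (n - card J) * principal_minor n J H)"
proof -
  have "det (mat n n (\<lambda>(i, j). H i j + (if i = j then b else 0))) =
     (\<Sum>p | p permutes {0..<n}. signof p * (\<Prod>i=0..<n. H i (p i) + (if i = p i then b else 0)))"
    by (subst det_def'[where n = n], simp)
      (intro sum.cong refl arg_cong2[where f = "(*)"] prod.cong, auto simp: permutes_in_image)
  also have "\<dots> = (\<Sum>p | p permutes {0..<n}. \<Sum>J\<in>Pow {0..<n}. b ^ (n - card J) *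
     (signof p * (\<Prod>i=0..<n. if i \<in> J then H i (p i) else if i = p i then 1 else 0)))"
  proof (rule sum.cong[OF refl], subst prod_add, simp, subst sum_distrib_left, rule sum.cong[OF refl])
    fix p J assume J: "J \<in> Pow {0..<n}"
    have "(\<Prod>i\<in>{0..<n} - J. if i = p i then b else 0) =
        (\<Prod>i\<in>{0..<n} - J. b * (if i = p i then 1 else 0))"
      by (intro prod.cong) auto
    also have "\<dots> = b ^ (n - card J) * (\<Prod>i\<in>{0..<n} - J. if i = p i then 1 else 0)"
      using J by (simp add: prod.distrib card_Diff_subset finite_subset)
    finally have 1: "(\<Prod>i\<in>{0..<n} - J. if i = p i then b else 0) =
      b ^ (n - card J) * (\<Prod>i\<in>{0..<n} - J. if i = p i then 1 else 0)" .
    have "(\<Prod>i=0..<n. if i \<in> J then H i (p i) else if i = p i then 1 else 0) =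
      (\<Prod>i\<in>{0..<n} - J. if i \<in> J then H i (p i) else if i = p i then 1 else 0) *
      (\<Prod>i\<in>J. if i \<in> J then H i (p i) else if i = p i then 1 else 0)"
      using J by (intro prod.subset_diff) auto
    also have "\<dots> = (\<Prod>i\<in>{0..<n} - J. if i = p i then 1 else 0) * (\<Prod>i\<in>J. H i (p i))"
      by (intro arg_cong2[where f = "(*)"] prod.cong) auto
    finally show "signof p * ((\<Prod>x\<in>J. H x (p x)) * (\<Prod>x\<in>{0..<n} - J. if x = p x then b else 0)) =
      b ^ (n - card J) *
     (signof p * (\<Prod>i=0..<n. if i \<in> J then H i (p i) else if i = p i then 1 else 0))"
      by (simp add: 1 mult_ac)
  qed
  also have "\<dots> = (\<Sum>J\<in>Pow {0..<n}. b ^ (n - card J) * principal_minor n J H)"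
    unfolding principal_minor_leibniz sum_distrib_left by (rule sum.swap)
  finally show ?thesis .
qed

section \<open>Determinants from eigenvalues, and positivity of Gram minors\<close>

text \<open>Both sides are read off from the characteristic polynomial at 0, where two factors
  \<open>(-1) ^ n\<close> cancel.\<close>

lemma det_eq_prod_list_eigenvalues:
  fixes A :: "complex mat"
  assumes A: "A \<in> carrier_mat n n" and as: "char_poly A = (\<Prod>a\<leftarrow>as. [:- a, 1:])" "length as = n"
  shows "det A = prod_list as"
proof -
  have "poly (char_poly A) 0 = det (- A)"
    using A by (subst char_poly_matrix[OF A]) (auto intro!: arg_cong[where f = det] simp: char_matrix_def)
  also have "- A = (-1) \<cdot>\<^sub>m A" using A by auto
  also have "det \<dots> = (-1) ^ n * det A" using A by simp
  finally have "det A = (-1) ^ n * poly (char_poly A) 0"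
    by (simp add: power_mult_distrib[symmetric] mult.assoc[symmetric])
  also have "poly (char_poly A) 0 = (\<Prod>a\<leftarrow>as. - a)"
    unfolding as by (simp add: poly_prod_list o_def)
  also have "\<dots> = (-1) ^ n * prod_list as"
    unfolding as(2)[symmetric] by (induction as) auto
  finally show ?thesis
    by (simp add: power_mult_distrib[symmetric] mult.assoc[symmetric])
qed

lemma det_nonneg_if_eigenvalues_nonneg:
  fixes A :: "complex mat"
  assumes A: "A \<in> carrier_mat n n" and ev: "\<And>k. eigenvalue A k \<Longrightarrow> k \<in> \<real>\<^sub>\<ge>\<^sub>0"
  shows "det A \<in> \<real>\<^sub>\<ge>\<^sub>0"
proof -
  obtain as where as: "char_poly A = (\<Prod>a\<leftarrow>as. [:- a, 1:])" "length as = n"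
    using char_poly_factorized[OF A] by blast
  have "a \<in> \<real>\<^sub>\<ge>\<^sub>0" if "a \<in> set as" for a
  proof -
    have "poly (char_poly A) a = 0"
      unfolding as using that by (auto simp: poly_prod_list o_def prod_list_zero_iff)
    then show ?thesis using ev eigenvalue_root_char_poly[OF A] by blast
  qed
  then show ?thesis
    unfolding det_eq_prod_list_eigenvalues[OF A as] by (induction as) (auto simp: nonneg_Reals_mult_I)
qed

text \<open>\<open>minor_mat\<close> need not be Hermitian, so its eigenvalues are inspected
  directly. The unit rows force an eigenvector for \<open>e \<noteq> 1\<close> to vanish outside
  \<open>J\<close>; pairing the eigenvalue equation with that vector shows that \<open>e\<close>
  times a positive number is a sum of squares.\<close>

lemma principal_minor_gram_nonneg: "principal_minor n J (gram n Y) \<in> \<real>\<^sub>\<ge>\<^sub>0"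
  unfolding principal_minor_def
proof (rule det_nonneg_if_eigenvalues_nonneg[OF minor_mat_carrier])
  fix e assume "eigenvalue (minor_mat n J (gram n Y)) e"
  then obtain v where v: "v \<in> carrier_vec n" "v \<noteq> 0\<^sub>v n"
    and ve: "minor_mat n J (gram n Y) *\<^sub>v v = e \<cdot>\<^sub>v v"
    unfolding eigenvalue_def eigenvector_def by (auto simp: minor_mat_def)
  have eq: "(\<Sum>j=0..<n. (if i \<in> J then gram n Y i j else if i = j then 1 else 0) * v $ j) = e * v $ i"
    if "i < n" for i
  proof -
    have "(minor_mat n J (gram n Y) *\<^sub>v v) $ i = e * v $ i"
      using v that by (simp add: ve)
    then show ?thesis
      using v that by (simp add: minor_mat_def scalar_prod_def)
  qed
  show "e \<in> \<real>\<^sub>\<ge>\<^sub>0"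
  proof (cases "e = 1")
    case False
    have v0: "v $ i = 0" if "i < n" "i \<notin> J" for i
    proof -
      have "(\<Sum>j=0..<n. (if i = j then 1 else 0) * v $ j) = v $ i"
        using that by (simp add: if_distrib[of "\<lambda>x. x * _"] sum.delta cong: if_cong)
      then have "v $ i = e * v $ i" using eq[of i] that by simp
      then show ?thesis using False by simp
    qed
    have eq': "(\<Sum>j=0..<n. cnj (v $ i) * gram n Y i j * v $ j) = e * (cnj (v $ i) * v $ i)" if "i < n" for i
    proof (cases "i \<in> J")
      case True
      show ?thesis using arg_cong[OF eq[OF that], of "\<lambda>x. cnj (v $ i) * x"] True
        by (simp add: sum_distrib_left mult_ac)
    qed (simp add: v0 that)
    have "(\<Sum>i=0..<n. \<Sum>j=0..<n. cnj (v $ i) * gram n Y i j * v $ j) =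
      (\<Sum>k=0..<n. (\<Sum>i=0..<n. cnj (v $ i) * Y i k) * cnj (\<Sum>j=0..<n. cnj (v $ j) * Y j k))"
    proof -
      have "(\<Sum>i=0..<n. \<Sum>j=0..<n. cnj (v $ i) * gram n Y i j * v $ j) =
        (\<Sum>i=0..<n. \<Sum>j=0..<n. \<Sum>k=0..<n. (cnj (v $ i) * Y i k) * cnj (cnj (v $ j) * Y j k))"
        by (simp add: gram_def sum_distrib_left sum_distrib_right mult_ac)
      also have "\<dots> = (\<Sum>i=0..<n. \<Sum>k=0..<n. \<Sum>j=0..<n. (cnj (v $ i) * Y i k) * cnj (cnj (v $ j) * Y j k))"
        by (intro sum.cong refl sum.swap)
      also have "\<dots> = (\<Sum>k=0..<n. \<Sum>i=0..<n. \<Sum>j=0..<n. (cnj (v $ i) * Y i k) * cnj (cnj (v $ j) * Y j k))"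
        by (rule sum.swap)
      finally show ?thesis by (simp add: sum_product)
    qed
    also have "\<dots> = of_real (\<Sum>k=0..<n. (cmod (\<Sum>i=0..<n. cnj (v $ i) * Y i k))\<^sup>2)" (is "_ = of_real ?T")
      by (simp only: of_real_sum complex_norm_square)
    finally have T: "e * (\<Sum>i=0..<n. cnj (v $ i) * v $ i) = of_real ?T"
      by (simp add: eq' sum_distrib_left)
    have S: "(\<Sum>i=0..<n. cnj (v $ i) * v $ i) = of_real (\<Sum>i=0..<n. (cmod (v $ i))\<^sup>2)" (is "_ = of_real ?S")
      by (simp only: of_real_sum complex_norm_square mult.commute)
    obtain i where "i < n" "v $ i \<noteq> 0"
      using v by (metis eq_vecI carrier_vecD index_zero_vec)
    then have "?S > 0" by (intro sum_pos2[of _ i]) auto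
    then have "complex_of_real ?S \<noteq> 0" by (simp only: of_real_eq_0_iff)
    then have "e = of_real (?T / ?S)"
      using T unfolding S of_real_divide by (metis nonzero_mult_div_cancel_right)
    moreover have "?T / ?S \<ge> 0" by (intro divide_nonneg_nonneg sum_nonneg) auto
    ultimately show ?thesis by (simp only: nonneg_Reals_of_real_iff)
  qed simp
qed

text \<open>Gram determinants grow by the squared distance of the new row to the span of the old rows, which is at
  least its squared component along any unit vector \<open>v\<close> orthogonal to that span. Here this is read off
  from \<open>Y Y\<^sup>* = Y (1 - v v\<^sup>*) Y\<^sup>* + (Y v) (Y v)\<^sup>*\<close>.\<close>

lemma principal_minor_gram_insert_ge:
  fixes v :: "nat \<Rightarrow> complex"
  assumes i: "i < n" "i \<notin> J" and v1: "(\<Sum>k=0..<n. (cmod (v k))\<^sup>2) = 1"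
    and orth: "\<And>j. j \<in> J \<Longrightarrow> j < n \<Longrightarrow> (\<Sum>k=0..<n. Y j k * v k) = 0"
  shows "(cmod (\<Sum>k=0..<n. Y i k * v k))\<^sup>2 * Re (principal_minor n J (gram n Y))
     \<le> Re (principal_minor n (insert i J) (gram n Y))"
proof -
  define z where "z l = (\<Sum>k=0..<n. Y l k * v k)" for l
  define Y' where "Y' l k = Y l k - z l * cnj (v k)" for l k
  \<comment> \<open>Only row \<open>i\<close> is replaced by its rank-one part. Since
    \<open>z\<close> vanishes on \<open>J\<close>, the rows in \<open>J\<close> are the same for
    \<open>gram n Y\<close> and \<open>gram n Y'\<close>.\<close>
  define c where "c l j = (if l = i then z i * cnj (z j) else gram n Y l j)" for l j
  have vv: "(\<Sum>k=0..<n. v k * cnj (v k)) = 1"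
    using arg_cong[OF v1, of complex_of_real] by (simp only: of_real_sum complex_norm_square of_real_1)
  have gY': "gram n Y' l j = gram n Y l j - z l * cnj (z j)" for l j
  proof -
    have "gram n Y' l j = (\<Sum>k=0..<n. Y l k * cnj (Y j k)) - (\<Sum>k=0..<n. Y l k * v k) * cnj (z j)
       - z l * cnj (\<Sum>k=0..<n. Y j k * v k) + z l * cnj (z j) * (\<Sum>k=0..<n. v k * cnj (v k))"
      unfolding gram_def Y'_def
      by (simp add: sum_distrib_left sum_distrib_right algebra_simps sum.distrib sum_subtractf)
    then show ?thesis unfolding vv by (simp add: gram_def z_def[symmetric])
  qed
  \<comment> \<open>The determinant is linear in row \<open>i\<close>, the only row in which the
    three matrices differ.\<close>
  have "principal_minor n (insert i J) (gram n Y) =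
     principal_minor n (insert i J) (gram n Y') + principal_minor n (insert i J) c"
    unfolding principal_minor_leibniz sum.distrib[symmetric] distrib_left[symmetric]
  proof (intro sum.cong refl arg_cong2[where f = "(*)"])
    fix p
    let ?P = "\<lambda>H. (\<Prod>l=0..<n. if l \<in> insert i J then H l (p l) else if l = p l then 1 else (0::complex))"
    have P: "?P H = H i (p i) * (\<Prod>l\<in>{0..<n} - {i}. if l \<in> J then gram n Y l (p l) else if l = p l then 1 else 0)"
      if "\<And>l j. l \<in> J \<Longrightarrow> l < n \<Longrightarrow> H l j = gram n Y l j" for H
    proof -
      have "?P H = H i (p i) * (\<Prod>l\<in>{0..<n} - {i}. if l \<in> insert i J then H l (p l) else if l = p l then 1 else 0)"
        using i by (subst prod.remove[of _ i]) auto
      also have "(\<Prod>l\<in>{0..<n} - {i}. if l \<in> insert i J then H l (p l) else if l = p l then 1 else 0) =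
        (\<Prod>l\<in>{0..<n} - {i}. if l \<in> J then gram n Y l (p l) else if l = p l then 1 else 0)"
        by (intro prod.cong) (auto simp: that)
      finally show ?thesis .
    qed
    have "?P (gram n Y') = gram n Y' i (p i) * (\<Prod>l\<in>{0..<n} - {i}. if l \<in> J then gram n Y l (p l) else if l = p l then 1 else 0)"
      by (intro P) (simp add: gY' z_def orth)
    moreover have "?P c = c i (p i) * (\<Prod>l\<in>{0..<n} - {i}. if l \<in> J then gram n Y l (p l) else if l = p l then 1 else 0)"
      by (intro P) (use i in \<open>auto simp: c_def\<close>)
    ultimately show "?P (gram n Y) = ?P (gram n Y') + ?P c"
      by (subst P) (auto simp: gY' c_def algebra_simps)
  qed
  \<comment> \<open>A permutation contributing to either side fixes every index outside
    \<open>insert i J\<close>, so \<open>p i\<close> is \<open>i\<close> or lies in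
    \<open>J\<close>; in the latter case \<open>z (p i) = 0\<close>.\<close>
  also have "principal_minor n (insert i J) c = z i * cnj (z i) * principal_minor n J (gram n Y)"
    unfolding principal_minor_leibniz sum_distrib_left
  proof (intro sum.cong refl)
    fix p assume "p \<in> {p. p permutes {0..<n}}"
    then have p: "p permutes {0..<n}" by simp
    let ?L = "(\<Prod>l=0..<n. if l \<in> insert i J then c l (p l) else if l = p l then 1 else (0::complex))"
    let ?R = "(\<Prod>l=0..<n. if l \<in> J then gram n Y l (p l) else if l = p l then 1 else (0::complex))"
    have "?L = z i * cnj (z i) * ?R"
    proof (cases "\<forall>l<n. l \<notin> J \<longrightarrow> p l = l")
      case True
      have "?L = c i (p i) * (\<Prod>l\<in>{0..<n} - {i}. if l \<in> J then gram n Y l (p l) else if l = p l then 1 else 0)"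
      proof -
        have "?L = c i (p i) * (\<Prod>l\<in>{0..<n} - {i}. if l \<in> insert i J then c l (p l) else if l = p l then 1 else 0)"
          using i by (subst prod.remove[of _ i]) auto
        also have "(\<Prod>l\<in>{0..<n} - {i}. if l \<in> insert i J then c l (p l) else if l = p l then 1 else 0) =
          (\<Prod>l\<in>{0..<n} - {i}. if l \<in> J then gram n Y l (p l) else if l = p l then 1 else 0)"
          by (intro prod.cong) (auto simp: c_def)
        finally show ?thesis .
      qed
      moreover have "?R = (\<Prod>l\<in>{0..<n} - {i}. if l \<in> J then gram n Y l (p l) else if l = p l then 1 else 0)"
        using i True by (subst prod.remove[of _ i]) auto
      moreover have "c i (p i) = z i * cnj (z i)" using True i by (simp add: c_def)
      ultimately show ?thesis by simp
    next
      case False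
      then obtain l where l: "l < n" "l \<notin> J" "p l \<noteq> l" by blast
      then have "?R = 0" by (intro prod_zero) (auto intro!: bexI[of _ l])
      moreover have "?L = 0"
      proof (cases "\<exists>l<n. l \<notin> insert i J \<and> p l \<noteq> l")
        case True
        then show ?thesis by (auto intro!: prod_zero)
      next
        case False
        then have "l = i" using l by auto
        have "p i < n" using p i permutes_in_image[OF p, of i] by simp
        moreover have "p i \<in> J"
        proof (rule ccontr)
          assume "p i \<notin> J"
          then have "p (p i) = p i" using False \<open>p i < n\<close> l \<open>l = i\<close> by auto
          then show False using permutes_inj[OF p] l \<open>l = i\<close> by (auto dest: injD)
        qed
        ultimately have "z (p i) = 0" by (simp add: z_def orth)
        then show ?thesis using i by (auto intro!: prod_zero bexI[of _ i] simp: c_def)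
      qed
      ultimately show ?thesis by (simp only: mult_zero_right)
    qed
    then show "signof p * ?L = z i * cnj (z i) * (signof p * ?R)" by simp
  qed
  also have "z i * cnj (z i) = of_real ((cmod (z i))\<^sup>2)" by (simp only: complex_norm_square)
  finally have "Re (principal_minor n (insert i J) (gram n Y)) =
     Re (principal_minor n (insert i J) (gram n Y')) + (cmod (z i))\<^sup>2 * Re (principal_minor n J (gram n Y))"
    by (simp del: of_real_power)
  \<comment> \<open>The discarded term is itself a Gram minor, for the rows with their component
    along \<open>v\<close> removed.\<close>
  moreover have "Re (principal_minor n (insert i J) (gram n Y')) \<ge> 0"
    using principal_minor_gram_nonneg by (auto simp: complex_nonneg_Reals_iff)
  ultimately show ?thesis by (simp add: z_def)
qed

section \<open>Averages over roots of unity\<close>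

lemma cis_unit_root_power: "m > 0 \<Longrightarrow> cis (2 * pi * real k / real m) ^ m = 1"
  using cis_multiple_2pi[of "real k"] by (simp add: Complex.DeMoivre)

text \<open>A geometric sum whose ratio \<open>w\<close> differs from 1, because \<open>m\<close>
  does not divide \<open>n\<close>.\<close>

lemma sum_unit_roots_power:
  assumes "0 < n" "n < m"
  shows "(\<Sum>k<m. cis (2 * pi * real k / real m) ^ n) = 0"
proof -
  define w where "w = cis (2 * pi * real n / real m)"
  have "w \<noteq> 1"
  proof
    assume "w = 1"
    then have "cos (2 * pi * real n / real m) = 1" by (simp add: w_def complex_eq_iff)
    then obtain j :: int where "2 * pi * real n / real m = of_int j * 2 * pi"
      unfolding cos_one_2pi_int by blast
    then have "real n = of_int j * real m" using assms by (simp add: field_simps)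
    then have j: "int n = j * int m" by (metis of_int_eq_iff of_int_mult of_int_of_nat_eq)
    then have "int m dvd int n" by simp
    then show False using assms by (auto dest: dvd_imp_le)
  qed
  have "(\<Sum>k<m. cis (2 * pi * real k / real m) ^ n) = (\<Sum>k<m. w ^ k)"
    by (intro sum.cong refl) (simp add: w_def Complex.DeMoivre mult_ac)
  also have "\<dots> = (w ^ m - 1) / (w - 1)" by (rule geometric_sum[OF \<open>w \<noteq> 1\<close>])
  also have "w ^ m = 1"
    using assms cis_unit_root_power[of m n] by (simp add: w_def)
  finally show ?thesis by simp
qed

text \<open>The geometric series closes up after \<open>m\<close> terms because the roots satisfy
  \<open>w ^ m = 1\<close>; only its constant term survives the sum. The average over the whole
  circle would be 1, so \<open>1 / (1 - q ^ m)\<close> is the price of discretization.\<close>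

lemma sum_inverse_one_minus_unit_roots:
  fixes q :: complex
  assumes "m > 0" "cmod q < 1"
  shows "(\<Sum>k<m. 1 / (1 - q * cis (2 * pi * real k / real m))) = of_nat m / (1 - q ^ m)"
proof -
  have "q ^ m \<noteq> 1"
  proof
    assume "q ^ m = 1"
    then have "cmod q ^ m = 1" by (metis norm_power norm_one)
    then show False using assms power_less_one_iff[of "cmod q" m] by simp
  qed
  have eq: "1 / (1 - q * cis (2 * pi * real k / real m)) =
     (\<Sum>n<m. q ^ n * cis (2 * pi * real k / real m) ^ n) / (1 - q ^ m)" for k
  proof -
    define u where "u = q * cis (2 * pi * real k / real m)"
    have "cmod u < 1" using assms by (simp add: u_def norm_mult)
    then have "u \<noteq> 1" by auto
    have "u ^ m = q ^ m * cis (2 * pi * real k / real m) ^ m" by (simp add: u_def power_mult_distrib)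
    also have "cis (2 * pi * real k / real m) ^ m = 1"
      using assms by (simp add: cis_unit_root_power)
    finally have "(1 - u) * (\<Sum>n<m. u ^ n) = 1 - q ^ m"
      using one_diff_power_eq[of u m] by simp
    then show ?thesis using \<open>u \<noteq> 1\<close> \<open>q ^ m \<noteq> 1\<close>
      unfolding u_def[symmetric] power_mult_distrib[symmetric] by (simp add: field_simps)
  qed
  have "(\<Sum>k<m. \<Sum>n<m. q ^ n * cis (2 * pi * real k / real m) ^ n) =
     (\<Sum>n<m. q ^ n * (\<Sum>k<m. cis (2 * pi * real k / real m) ^ n))"
    by (subst sum.swap) (simp add: sum_distrib_left)
  also have "\<dots> = (\<Sum>n<m. if n = 0 then of_nat m else 0)"
    by (intro sum.cong) (auto simp: sum_unit_roots_power)
  also have "\<dots> = of_nat m" using assms by simp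
  finally show ?thesis unfolding eq sum_divide_distrib[symmetric] by simp
qed

section \<open>The Poisson kernel and its average over roots of unity\<close>

text \<open>The Poisson kernel is the real part of \<open>(1 + u) / (1 - u)\<close>. This form is
  affine in \<open>1 / (1 - u)\<close>, whose sum over roots of unity is known.\<close>

lemma inverse_norm_one_minus_squared:
  fixes u :: complex
  assumes "cmod u < 1"
  shows "1 / (cmod (1 - u))\<^sup>2 = (2 * Re (1 / (1 - u)) - 1) / (1 - (cmod u)\<^sup>2)"
proof -
  have ne: "1 - u \<noteq> 0" using assms by auto
  then have pos: "(cmod (1 - u))\<^sup>2 > 0" by simp
  have "(cmod u)\<^sup>2 < 1" using assms by (simp add: power_less_one_iff)
  have "2 * Re (1 / (1 - u)) - 1 = 2 * ((1 - Re u) / (cmod (1 - u))\<^sup>2) - 1"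
    by (simp add: Re_divide cmod_power2)
  also have "\<dots> = (2 * (1 - Re u) - (cmod (1 - u))\<^sup>2) / (cmod (1 - u))\<^sup>2"
    using pos by (simp add: diff_divide_distrib)
  also have "2 * (1 - Re u) - (cmod (1 - u))\<^sup>2 = 1 - (cmod u)\<^sup>2"
    unfolding cmod_power2 by (simp add: power2_eq_square algebra_simps)
  finally show ?thesis using \<open>(cmod u)\<^sup>2 < 1\<close> by simp
qed

text \<open>Factoring out \<open>a\<close> leaves a Poisson kernel at \<open>q = z / a\<close>. Its
  circle average gives \<open>1 / (|a|^2 - |z|^2)\<close>, and discretization costs at most a factor
  2.\<close>

lemma sum_unit_roots_inverse_norm_squared_le:
  fixes a z :: complex
  assumes m: "m > 0" and g: "0 \<le> \<gamma>" "\<gamma> < 1" "\<gamma> ^ m \<le> 1/3"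
    and a: "cmod a \<le> 1" and az: "1 - \<gamma>\<^sup>2 \<le> (cmod a)\<^sup>2 - (cmod z)\<^sup>2"
  shows "(\<Sum>k<m. 1 / (cmod (a - cis (2 * pi * real k / real m) * z))\<^sup>2) \<le> real m * (2 / (1 - \<gamma>\<^sup>2))"
proof -
  define q where "q = z / a"
  have g2: "\<gamma>\<^sup>2 < 1" using g by (simp add: power_less_one_iff)
  have a0: "a \<noteq> 0" using az g2 by (smt (verit) norm_zero zero_le_power2 zero_power2)
  have a1: "(cmod a)\<^sup>2 \<le> 1" using a by (simp add: power_le_one)
  \<comment> \<open>As \<open>|a| \<le> 1\<close>, the gap \<open>1 - \<gamma>\<^sup>2\<close> is at
    least \<open>(1 - \<gamma>\<^sup>2) |a|^2\<close>. This turns the difference in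
    \<open>az\<close> into the ratio bound \<open>|q| \<le> \<gamma>\<close>.\<close>
  have "(cmod z)\<^sup>2 \<le> (cmod a)\<^sup>2 - (1 - \<gamma>\<^sup>2)" using az by simp
  also have "\<dots> \<le> \<gamma>\<^sup>2 * (cmod a)\<^sup>2"
    using mult_left_mono[OF a1, of "1 - \<gamma>\<^sup>2"] g2 by (simp add: algebra_simps)
  also have "\<dots> = (\<gamma> * cmod a)\<^sup>2" by (simp add: power_mult_distrib)
  finally have "cmod z \<le> \<gamma> * cmod a" using g by (rule_tac power2_le_imp_le) auto
  then have q: "cmod q \<le> \<gamma>" using a0 by (simp add: q_def norm_divide field_simps)
  then have q1: "cmod q < 1" using g by simp
  then have q2: "(cmod q)\<^sup>2 < 1" by (simp add: power_less_one_iff)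
  have "(\<Sum>k<m. 1 / (cmod (a - cis (2 * pi * real k / real m) * z))\<^sup>2) =
    (\<Sum>k<m. 1 / (cmod (1 - q * cis (2 * pi * real k / real m)))\<^sup>2 / (cmod a)\<^sup>2)"
  proof (intro sum.cong refl)
    fix k
    have "a - cis (2 * pi * real k / real m) * z = a * (1 - q * cis (2 * pi * real k / real m))"
      using a0 by (simp add: q_def field_simps)
    then show "1 / (cmod (a - cis (2 * pi * real k / real m) * z))\<^sup>2 =
       1 / (cmod (1 - q * cis (2 * pi * real k / real m)))\<^sup>2 / (cmod a)\<^sup>2"
      by (simp add: norm_mult power_mult_distrib)
  qed
  also have "\<dots> = (\<Sum>k<m. (2 * Re (1 / (1 - q * cis (2 * pi * real k / real m))) - 1)) / (1 - (cmod q)\<^sup>2) / (cmod a)\<^sup>2"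
    unfolding sum_divide_distrib
    by (intro sum.cong refl) (subst inverse_norm_one_minus_squared, use q1 in \<open>auto simp: norm_mult\<close>)
  also have "(\<Sum>k<m. (2 * Re (1 / (1 - q * cis (2 * pi * real k / real m))) - 1)) =
     2 * Re (\<Sum>k<m. 1 / (1 - q * cis (2 * pi * real k / real m))) - real m"
    by (simp add: sum_subtractf sum_distrib_left)
  also have "\<dots> = real m * (2 * Re (1 / (1 - q ^ m)) - 1)"
    unfolding sum_inverse_one_minus_unit_roots[OF m q1]
    by (simp add: algebra_simps Re_divide_of_real divide_inverse)
  also have "real m * (2 * Re (1 / (1 - q ^ m)) - 1) \<le> real m * 2"
  \<comment> \<open>From \<open>\<gamma> ^ m \<le> 1/3\<close> the denominator has modulus at least
    2/3, so the real part is at most 3/2.\<close>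
  proof (intro mult_left_mono)
    have "cmod (q ^ m) \<le> \<gamma> ^ m" using q by (simp add: norm_power power_mono)
    then have "cmod (q ^ m) \<le> 1/3" using g by simp
    then have "cmod (1 - q ^ m) \<ge> 2/3"
      using norm_triangle_ineq2[of 1 "q ^ m"] by simp
    then have "1 / cmod (1 - q ^ m) \<le> 1 / (2/3)" by (intro divide_left_mono) auto
    then have "cmod (1 / (1 - q ^ m)) \<le> 3/2" by (simp add: norm_divide)
    then have "Re (1 / (1 - q ^ m)) \<le> 3/2" using complex_Re_le_cmod order_trans by blast
    then show "2 * Re (1 / (1 - q ^ m)) - 1 \<le> 2" by simp
  qed simp
  also have "real m * 2 / (1 - (cmod q)\<^sup>2) / (cmod a)\<^sup>2 = real m * (2 / ((cmod a)\<^sup>2 - (cmod z)\<^sup>2))"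
  proof -
    have "(1 - (cmod q)\<^sup>2) * (cmod a)\<^sup>2 = (cmod a)\<^sup>2 - (cmod z)\<^sup>2"
      using a0 by (simp add: q_def norm_divide power_divide left_diff_distrib)
    then show ?thesis by (simp add: divide_divide_eq_left)
  qed
  also have "\<dots> \<le> real m * (2 / (1 - \<gamma>\<^sup>2))"
    using az g2 by (intro mult_left_mono divide_left_mono mult_pos_pos) auto
  finally show ?thesis using q2 by (simp add: divide_right_mono)
qed

section \<open>Row rotations of unitary matrices\<close>

lemma mat_adjoint_index:
  fixes A :: "complex mat"
  assumes "i < dim_col A" "j < dim_row A"
  shows "mat_adjoint A $$ (i, j) = cnj (A $$ (j, i))"
  using assms by (simp add: mat_adjoint_def mat_of_rows_def conjugate_complex_def)

lemma mat_adjoint_carrier: "A \<in> carrier_mat n m \<Longrightarrow> mat_adjoint (A :: complex mat) \<in> carrier_mat m n"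
  by (auto simp: mat_adjoint_def)

lemma unitary_group_iff:
  "g \<in> unitary_group n \<longleftrightarrow> g \<in> carrier_mat n n \<and>
    (\<forall>i<n. \<forall>j<n. (\<Sum>k=0..<n. g $$ (i, k) * cnj (g $$ (j, k))) = (if i = j then 1 else 0)) \<and>
    (\<forall>i<n. \<forall>j<n. (\<Sum>k=0..<n. cnj (g $$ (k, i)) * g $$ (k, j)) = (if i = j then 1 else 0))"
proof (cases "g \<in> carrier_mat n n")
  case True
  have "g * mat_adjoint g = 1\<^sub>m n \<longleftrightarrow>
    (\<forall>i<n. \<forall>j<n. (\<Sum>k=0..<n. g $$ (i, k) * cnj (g $$ (j, k))) = (if i = j then 1 else 0))"
    using True mat_adjoint_carrier[OF True]
    by (auto simp: mat_eq_iff scalar_prod_def mat_adjoint_index)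
  moreover have "mat_adjoint g * g = 1\<^sub>m n \<longleftrightarrow>
    (\<forall>i<n. \<forall>j<n. (\<Sum>k=0..<n. cnj (g $$ (k, i)) * g $$ (k, j)) = (if i = j then 1 else 0))"
    using True mat_adjoint_carrier[OF True]
    by (auto simp: mat_eq_iff scalar_prod_def mat_adjoint_index)
  ultimately show ?thesis using True by (simp add: unitary_group_def)
qed (simp add: unitary_group_def)

text \<open>Expanding the squares leaves inner products of columns of \<open>g\<close>, which are
  orthonormal.\<close>

lemma unitary_norm_preserving:
  assumes g: "g \<in> unitary_group n"
  shows "(\<Sum>l=0..<n. (cmod (\<Sum>k=0..<n. g $$ (l, k) * v k))\<^sup>2) = (\<Sum>k=0..<n. (cmod (v k))\<^sup>2)"
proof -
  have "complex_of_real (\<Sum>l=0..<n. (cmod (\<Sum>k=0..<n. g $$ (l, k) * v k))\<^sup>2) =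
    (\<Sum>l=0..<n. \<Sum>k=0..<n. \<Sum>j=0..<n. g $$ (l, k) * v k * cnj (g $$ (l, j) * v j))"
    by (simp only: of_real_sum complex_norm_square sum_product cnj_sum)
  also have "\<dots> = (\<Sum>k=0..<n. \<Sum>l=0..<n. \<Sum>j=0..<n. g $$ (l, k) * v k * cnj (g $$ (l, j) * v j))"
    by (rule sum.swap)
  also have "\<dots> = (\<Sum>k=0..<n. \<Sum>j=0..<n. \<Sum>l=0..<n. g $$ (l, k) * v k * cnj (g $$ (l, j) * v j))"
    by (intro sum.cong refl sum.swap)
  also have "\<dots> = (\<Sum>k=0..<n. \<Sum>j=0..<n. v k * cnj (v j) * (\<Sum>l=0..<n. cnj (g $$ (l, j)) * g $$ (l, k)))"
    by (simp add: sum_distrib_left mult_ac)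
  also have "\<dots> = (\<Sum>k=0..<n. \<Sum>j=0..<n. if j = k then v k * cnj (v k) else 0)"
    using g by (intro sum.cong refl) (auto simp: unitary_group_iff)
  also have "\<dots> = complex_of_real (\<Sum>k=0..<n. (cmod (v k))\<^sup>2)"
    by (simp only: of_real_sum complex_norm_square) (simp add: sum.delta')
  finally show ?thesis by (simp only: of_real_eq_iff)
qed

section \<open>Gram minors of the rows of \<open>1 - \<gamma>g\<close> under row rotations\<close>

definition resolvent_rows :: "real \<Rightarrow> complex mat \<Rightarrow> nat \<Rightarrow> nat \<Rightarrow> complex" where
  "resolvent_rows \<gamma> g l k = (if l = k then 1 else 0) - of_real \<gamma> * g $$ (l, k)"

text \<open>This is \<open>G\<^sub>J\<close> for \<open>Y = 1 - \<gamma>g\<close>. The minor is a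
  nonnegative real by \<open>principal_minor_gram_nonneg\<close>, so \<open>Re\<close> only changes
  the type.\<close>

definition row_gram :: "nat \<Rightarrow> real \<Rightarrow> nat set \<Rightarrow> complex mat \<Rightarrow> real" where
  "row_gram n \<gamma> J g = Re (principal_minor n J (gram n (resolvent_rows \<gamma> g)))"

definition rot :: "nat \<Rightarrow> nat \<Rightarrow> complex \<Rightarrow> complex mat" where
  "rot n i w = mat n n (\<lambda>(l, k). if l = k then if l = i then w else 1 else 0)"

lemma row_gram_nonneg: "row_gram n \<gamma> J g \<ge> 0"
  using principal_minor_gram_nonneg[of n J] by (auto simp: row_gram_def complex_nonneg_Reals_iff)

lemma row_gram_empty: "row_gram n \<gamma> {} g = 1"
proof -
  have "minor_mat n {} H = 1\<^sub>m n" for H by (auto simp: minor_mat_def)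
  then show ?thesis by (simp add: row_gram_def principal_minor_def)
qed

lemma resolvent_rows_mult:
  "l < n \<Longrightarrow> (\<Sum>k=0..<n. resolvent_rows \<gamma> g l k * v k) = v l - of_real \<gamma> * (\<Sum>k=0..<n. g $$ (l, k) * v k)"
  by (simp add: resolvent_rows_def left_diff_distrib sum_subtractf sum_distrib_left mult.assoc
      if_distrib[of "\<lambda>x. x * _"] cong: if_cong)

lemma rot_mult_index:
  assumes "g \<in> carrier_mat n n" "l < n" "k < n"
  shows "(rot n i w * g) $$ (l, k) = (if l = i then w else 1) * g $$ (l, k)"
  using assms
  by (simp add: rot_def scalar_prod_def if_distrib[of "\<lambda>x. x * _"] cong: if_cong)

lemma rot_unitary:
  assumes "cmod w = 1"
  shows "rot n i w \<in> unitary_group n"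
proof -
  have "w * cnj w = 1" "cnj w * w = 1"
    using assms complex_norm_square[of w] by (simp_all add: mult.commute)
  then show ?thesis
    by (auto simp: unitary_group_iff rot_def if_distrib[of "\<lambda>x. x * _"] if_distrib[of cnj] cong: if_cong)
qed

text \<open>Only row \<open>i\<close> of \<open>Y\<close> changes, yet the matrix behind the minor
  still has entries in rows of \<open>J\<close> and column \<open>i\<close>. They occur only for
  permutations that move an index outside \<open>J\<close>, and those contribute 0; all others map
  \<open>J\<close> to itself.\<close>

lemma row_gram_rot:
  assumes "g \<in> carrier_mat n n" "i \<notin> J" "J \<subseteq> {0..<n}"
  shows "row_gram n \<gamma> J (rot n i w * g) = row_gram n \<gamma> J g"
  unfolding row_gram_def
proof (intro arg_cong[where f = Re])
  let ?g = "rot n i w * g"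
  have row: "resolvent_rows \<gamma> ?g l k = resolvent_rows \<gamma> g l k" if "l \<noteq> i" "l < n" "k < n" for l k
    using that by (simp add: resolvent_rows_def rot_mult_index[OF assms(1)])
  let ?X = "gram n (resolvent_rows \<gamma> g)" and ?X' = "gram n (resolvent_rows \<gamma> ?g)"
  show "principal_minor n J ?X' = principal_minor n J ?X"
    unfolding principal_minor_leibniz
  proof (intro sum.cong refl arg_cong2[where f = "(*)"])
    fix p assume "p \<in> {p. p permutes {0..<n}}"
    then have p: "p permutes {0..<n}" by simp
    let ?P = "\<lambda>H. \<Prod>l=0..<n. if l \<in> J then H l (p l) else if l = p l then 1 else (0::complex)"
    show "?P ?X' = ?P ?X"
    proof (cases "\<forall>l<n. l \<notin> J \<longrightarrow> p l = l")
      case True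
      have "p l \<in> J" if "l \<in> J" for l
      proof (rule ccontr)
        assume "p l \<notin> J"
        moreover have "p l < n" using that assms(3) permutes_in_image[OF p, of l] by auto
        ultimately have "p (p l) = p l" using True by blast
        then have "p l = l" using permutes_inj[OF p] by (auto dest: injD)
        then show False using that \<open>p l \<notin> J\<close> by simp
      qed
      then have "?X' l (p l) = ?X l (p l)" if "l \<in> J" for l
        unfolding gram_def using that assms(2,3)
        by (intro sum.cong refl) (metis (mono_tags, lifting) row atLeastLessThan_iff subsetD)
      then show ?thesis by (intro prod.cong) auto
    next
      case False
      then obtain l where "l < n" "l \<notin> J" "p l \<noteq> l" by blast
      then have "?P H = 0" for H by (intro prod_zero) (auto intro!: bexI[of _ l])
      then show ?thesis by (simp only:)
    qed
  qed
qed

text \<open>The vector \<open>v\<close> is in addition supported on \<open>insert i J\<close>, which leaves \<open>n - 1\<close> homogeneous linear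
  equations. On \<open>J\<close> the equations say \<open>v\<^sub>j = \<gamma> (g v)\<^sub>j\<close>, and \<open>g\<close>
  preserves the norm, so \<open>v\<close> must have mass at \<open>i\<close>.\<close>

lemma test_vector_exists:
  assumes g: "g \<in> unitary_group n" and i: "i < n" "i \<notin> J" and J: "J \<subseteq> {0..<n}"
  obtains v where "(\<Sum>k=0..<n. (cmod (v k))\<^sup>2) = 1"
    "\<And>j. j \<in> J \<Longrightarrow> (\<Sum>k=0..<n. resolvent_rows \<gamma> g j k * v k) = 0"
    "1 - \<gamma>\<^sup>2 \<le> (cmod (v i))\<^sup>2 - (cmod (of_real \<gamma> * (\<Sum>k=0..<n. g $$ (i, k) * v k)))\<^sup>2"
proof -
  \<comment> \<open>Rows in \<open>J\<close> are the orthogonality equations, and rows outside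
    \<open>insert i J\<close> force an entry of the solution to vanish. Row \<open>i\<close> is
    zero, which makes \<open>A\<close> singular.\<close>
  define A where "A = mat n n (\<lambda>(l, k). if l \<in> J then resolvent_rows \<gamma> g l k
     else if l \<noteq> i \<and> l = k then 1 else 0)"
  have A: "A \<in> carrier_mat n n" by (simp add: A_def)
  have "det A = 0"
    unfolding det_def'[OF A]
  proof (intro sum.neutral ballI)
    fix p assume "p \<in> {p. p permutes {0..<n}}"
    then have "p i < n" using i permutes_in_image[of p "{0..<n}" i] by auto
    then have "(\<Prod>l=0..<n. A $$ (l, p l)) = 0"
      using i by (intro prod_zero bexI[of _ i]) (auto simp: A_def)
    then show "signof p * (\<Prod>l=0..<n. A $$ (l, p l)) = 0" by simp
  qed
  then obtain u where u: "u \<in> carrier_vec n" "u \<noteq> 0\<^sub>v n" "A *\<^sub>v u = 0\<^sub>v n"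
    using det_0_iff_vec_prod_zero[OF A] by blast
  define s where "s = sqrt (\<Sum>k=0..<n. (cmod (u $ k))\<^sup>2)"
  define v where "v k = u $ k / of_real s" for k
  obtain k0 where "k0 < n" "u $ k0 \<noteq> 0"
    using u by (metis eq_vecI carrier_vecD index_zero_vec)
  then have "(\<Sum>k=0..<n. (cmod (u $ k))\<^sup>2) > 0" by (intro sum_pos2[of _ k0]) auto
  then have s: "s > 0" "s\<^sup>2 = (\<Sum>k=0..<n. (cmod (u $ k))\<^sup>2)" by (auto simp: s_def)
  have v1: "(\<Sum>k=0..<n. (cmod (v k))\<^sup>2) = 1"
    using s by (simp add: v_def norm_divide power_divide flip: s(2) sum_divide_distrib)
  have Au: "(\<Sum>k=0..<n. A $$ (l, k) * u $ k) = 0" if "l < n" for l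
  proof -
    have "(A *\<^sub>v u) $ l = 0" using u that by simp
    then show ?thesis using A u(1) that by (simp add: scalar_prod_def)
  qed
  have Av: "(\<Sum>k=0..<n. A $$ (l, k) * v k) = 0" if "l < n" for l
    using Au[OF that] by (simp add: v_def sum_divide_distrib[symmetric])
  have vJ: "(\<Sum>k=0..<n. resolvent_rows \<gamma> g j k * v k) = 0" if "j \<in> J" for j
    using Av[of j] that J by (auto simp: A_def)
  have v0: "v l = 0" if "l < n" "l \<notin> J" "l \<noteq> i" for l
    using Av[of l] that by (simp add: A_def if_distrib[of "\<lambda>x. x * _"] cong: if_cong)
  define y where "y l = (\<Sum>k=0..<n. g $$ (l, k) * v k)" for l
  have "(\<Sum>k\<in>{0..<n}-{i}. (cmod (v k))\<^sup>2) \<le> (\<Sum>k\<in>{0..<n}-{i}. \<gamma>\<^sup>2 * (cmod (y k))\<^sup>2)"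
  proof (intro sum_mono)
    fix k assume k: "k \<in> {0..<n}-{i}"
    show "(cmod (v k))\<^sup>2 \<le> \<gamma>\<^sup>2 * (cmod (y k))\<^sup>2"
    proof (cases "k \<in> J")
      case True
      then have "v k = of_real \<gamma> * y k"
        using vJ[OF True] k by (simp add: resolvent_rows_mult y_def)
      then show ?thesis by (simp add: norm_mult power_mult_distrib)
    qed (use v0 k in simp)
  qed
  moreover have "(\<Sum>k=0..<n. (cmod (v k))\<^sup>2) = (cmod (v i))\<^sup>2 + (\<Sum>k\<in>{0..<n}-{i}. (cmod (v k))\<^sup>2)"
    using i by (intro sum.remove) auto
  moreover have "(\<Sum>k=0..<n. \<gamma>\<^sup>2 * (cmod (y k))\<^sup>2) = \<gamma>\<^sup>2 * (cmod (y i))\<^sup>2 + (\<Sum>k\<in>{0..<n}-{i}. \<gamma>\<^sup>2 * (cmod (y k))\<^sup>2)"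
    using i by (intro sum.remove) auto
  moreover have "(\<Sum>k=0..<n. \<gamma>\<^sup>2 * (cmod (y k))\<^sup>2) = \<gamma>\<^sup>2"
    using unitary_norm_preserving[OF g, of v] v1 by (simp add: y_def sum_distrib_left[symmetric])
  ultimately have "1 - \<gamma>\<^sup>2 \<le> (cmod (v i))\<^sup>2 - \<gamma>\<^sup>2 * (cmod (y i))\<^sup>2" using v1 by linarith
  then show ?thesis using v1 vJ
    by (intro that[of v]) (simp_all add: y_def norm_mult power_mult_distrib)
qed

text \<open>One test vector \<open>v\<close> serves all rotations, since they leave the rows in
  \<open>J\<close> alone. Along \<open>v\<close>, the rotated row \<open>i\<close> has component
  \<open>v i - w * z\<close> for the phase \<open>w\<close>, so each ratio is at most the inverse
  square of its modulus.\<close>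

lemma row_gram_rot_average_le:
  assumes g: "g \<in> unitary_group n" and i: "i < n" "i \<notin> J" and J: "J \<subseteq> {0..<n}"
    and gam: "0 \<le> \<gamma>" "\<gamma> < 1" and m: "m > 0" "\<gamma> ^ m \<le> 1/3"
  shows "(\<Sum>k<m. row_gram n \<gamma> J g / row_gram n \<gamma> (insert i J) (rot n i (cis (2 * pi * real k / real m)) * g))
     \<le> real m * (2 / (1 - \<gamma>\<^sup>2))"
proof -
  define W where "W k = cis (2 * pi * real k / real m)" for k
  obtain v where v: "(\<Sum>k=0..<n. (cmod (v k))\<^sup>2) = 1" 
    "\<And>j. j \<in> J \<Longrightarrow> (\<Sum>k=0..<n. resolvent_rows \<gamma> g j k * v k) = 0"
    "1 - \<gamma>\<^sup>2 \<le> (cmod (v i))\<^sup>2 - (cmod (of_real \<gamma> * (\<Sum>k=0..<n. g $$ (i, k) * v k)))\<^sup>2"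
    using test_vector_exists[OF g i J] by blast
  define z where "z = of_real \<gamma> * (\<Sum>k=0..<n. g $$ (i, k) * v k)"
  have gc: "g \<in> carrier_mat n n" using g by (simp add: unitary_group_iff)
  have "(cmod (v i))\<^sup>2 \<le> (\<Sum>k=0..<n. (cmod (v k))\<^sup>2)"
    using i by (intro member_le_sum) auto
  then have vi: "cmod (v i) \<le> 1" using v(1) by (simp add: power_le_one_iff abs_square_le_1)
  have le: "row_gram n \<gamma> J g / row_gram n \<gamma> (insert i J) (rot n i (W k) * g) \<le> 1 / (cmod (v i - W k * z))\<^sup>2" for k
  proof -
    let ?R = "resolvent_rows \<gamma> (rot n i (W k) * g)"
    have R: "?R l j = (if l = i then (if l = j then 1 else 0) - of_real \<gamma> * (W k * g $$ (l, j)) else resolvent_rows \<gamma> g l j)"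
      if "l < n" "j < n" for l j
      using that by (simp add: resolvent_rows_def rot_mult_index[OF gc])
    have orth: "(\<Sum>k=0..<n. ?R j k * v k) = 0" if "j \<in> J" for j
    proof -
      have "(\<Sum>k=0..<n. ?R j k * v k) = (\<Sum>k=0..<n. resolvent_rows \<gamma> g j k * v k)"
        using that J i by (intro sum.cong refl) (subst R, auto)
      then show ?thesis using v(2)[OF that] by simp
    qed
    have "(\<Sum>j=0..<n. (rot n i (W k) * g) $$ (i, j) * v j) = W k * (\<Sum>j=0..<n. g $$ (i, j) * v j)"
      using i by (simp add: rot_mult_index[OF gc] sum_distrib_left mult.assoc)
    then have zi: "(\<Sum>k=0..<n. ?R i k * v k) = v i - W k * z"
      using i by (simp add: resolvent_rows_mult z_def)
    have ge: "(cmod (v i - W k * z))\<^sup>2 * row_gram n \<gamma> J g \<le> row_gram n \<gamma> (insert i J) (rot n i (W k) * g)"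
      using principal_minor_gram_insert_ge[where Y = ?R, OF i v(1)] orth row_gram_rot[OF gc i(2) J, of \<gamma> "W k"]
      by (simp add: zi row_gram_def)
    \<comment> \<open>The strict gap between \<open>|z|\<close> and \<open>|v i|\<close> makes the
      denominator nonzero for every phase.\<close>
    have "1 - \<gamma>\<^sup>2 > 0" using gam by (simp add: power_less_one_iff)
    then have "(cmod z)\<^sup>2 < (cmod (v i))\<^sup>2" using v(3) by (simp add: z_def)
    then have "cmod z < cmod (v i)" by (rule power2_less_imp_less) simp
    moreover have "cmod (W k * z) = cmod z" by (simp add: W_def norm_mult)
    ultimately have "v i - W k * z \<noteq> 0" by auto
    then have pos: "(cmod (v i - W k * z))\<^sup>2 > 0" by simp
    show ?thesis
    proof (cases "row_gram n \<gamma> J g = 0")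
      case False
      then have "row_gram n \<gamma> J g > 0" using row_gram_nonneg[of n \<gamma> J g] by simp
      moreover from this have "row_gram n \<gamma> (insert i J) (rot n i (W k) * g) > 0"
        using ge pos by (meson less_le_trans mult_pos_pos)
      ultimately show ?thesis using ge pos by (simp add: field_simps)
    qed simp
  qed
  have "(\<Sum>k<m. row_gram n \<gamma> J g / row_gram n \<gamma> (insert i J) (rot n i (W k) * g))
    \<le> (\<Sum>k<m. 1 / (cmod (v i - W k * z))\<^sup>2)" by (intro sum_mono le)
  also have "\<dots> \<le> real m * (2 / (1 - \<gamma>\<^sup>2))"
    unfolding W_def using m gam vi v(3)
    by (intro sum_unit_roots_inverse_norm_squared_le) (auto simp: z_def)
  finally show ?thesis by (simp add: W_def)
qed

text \<open>Rows are added one at a time; each new row has a nonzero component along the test vector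
  for the earlier ones.\<close>

lemma row_gram_pos:
  assumes g: "g \<in> unitary_group n" and gam: "0 \<le> \<gamma>" "\<gamma> < 1" and J: "J \<subseteq> {0..<n}"
  shows "row_gram n \<gamma> J g > 0"
proof -
  have "finite J" using J finite_subset by blast
  then show ?thesis using J
  proof (induction J)
    case empty
    then show ?case by (simp add: row_gram_empty)
  next
    case (insert i J)
    then have i: "i < n" "i \<notin> J" and J: "J \<subseteq> {0..<n}" by auto
    obtain v where v: "(\<Sum>k=0..<n. (cmod (v k))\<^sup>2) = 1" 
      "\<And>j. j \<in> J \<Longrightarrow> (\<Sum>k=0..<n. resolvent_rows \<gamma> g j k * v k) = 0"
      "1 - \<gamma>\<^sup>2 \<le> (cmod (v i))\<^sup>2 - (cmod (of_real \<gamma> * (\<Sum>k=0..<n. g $$ (i, k) * v k)))\<^sup>2"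
      using test_vector_exists[OF g i J] by blast
    have "1 - \<gamma>\<^sup>2 > 0" using gam by (simp add: power_less_one_iff)
    then have "v i \<noteq> of_real \<gamma> * (\<Sum>k=0..<n. g $$ (i, k) * v k)" using v(3) by auto
    then have "(cmod (\<Sum>k=0..<n. resolvent_rows \<gamma> g i k * v k))\<^sup>2 > 0"
      using i by (simp add: resolvent_rows_mult)
    then have "0 < (cmod (\<Sum>k=0..<n. resolvent_rows \<gamma> g i k * v k))\<^sup>2 * row_gram n \<gamma> J g"
      using insert.IH[OF J] by (rule mult_pos_pos)
    also have "\<dots> \<le> row_gram n \<gamma> (insert i J) g"
      unfolding row_gram_def by (rule principal_minor_gram_insert_ge[OF i v(1)]) (rule v(2))
    finally show ?case .
  qed
qed

section \<open>Integration against Haar measure\<close>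

lemma mat_adjoint_mult:
  fixes A B :: "complex mat"
  assumes "A \<in> carrier_mat n n" "B \<in> carrier_mat n n"
  shows "mat_adjoint (A * B) = mat_adjoint B * mat_adjoint A"
  using assms mat_adjoint_carrier[OF assms(1)] mat_adjoint_carrier[OF assms(2)]
    mat_adjoint_carrier[OF mult_carrier_mat[OF assms]]
  by (intro eq_matI) (auto simp: mat_adjoint_index scalar_prod_def mult.commute)

lemma mat_adjoint_adjoint:
  fixes A :: "complex mat"
  assumes "A \<in> carrier_mat n n"
  shows "mat_adjoint (mat_adjoint A) = A"
  using assms mat_adjoint_carrier[OF assms] mat_adjoint_carrier[OF mat_adjoint_carrier[OF assms]]
  by (intro eq_matI) (auto simp: mat_adjoint_index)

lemma unitary_group_carrier: "g \<in> unitary_group n \<Longrightarrow> g \<in> carrier_mat n n"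
  by (simp add: unitary_group_def)

lemma unitary_group_adjoint: "g \<in> unitary_group n \<Longrightarrow> mat_adjoint g \<in> unitary_group n"
  by (auto simp: unitary_group_def mat_adjoint_adjoint mat_adjoint_carrier)

lemma unitary_group_mult:
  assumes u: "u \<in> unitary_group n" and g: "g \<in> unitary_group n"
  shows "u * g \<in> unitary_group n"
proof -
  note c = unitary_group_carrier[OF u] unitary_group_carrier[OF g]
  note ac = c[THEN mat_adjoint_carrier]
  have "u * g * (mat_adjoint g * mat_adjoint u) = u * (g * mat_adjoint g) * mat_adjoint u"
    using c ac by (simp add: assoc_mult_mat[of _ n n _ n _ n])
  moreover have "mat_adjoint g * mat_adjoint u * (u * g) = mat_adjoint g * (mat_adjoint u * u) * g"
    using c ac by (simp add: assoc_mult_mat[of _ n n _ n _ n])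
  ultimately show ?thesis
    using u g c ac by (simp add: unitary_group_def mat_adjoint_mult[OF c])
qed

lemma measurable_entry:
  assumes M: "haar_prob n M" and "i < n" "j < n"
  shows "(\<lambda>g. g $$ (i, j)) \<in> borel_measurable M"
proof -
  have "(\<lambda>g. \<lambda>ij\<in>{..<n} \<times> {..<n}. g $$ ij) \<in> unitary_borel n \<rightarrow>\<^sub>M (\<Pi>\<^sub>M ij\<in>{..<n} \<times> {..<n}. (borel :: complex measure))"
    unfolding unitary_borel_def by (rule measurable_vimage_algebra1) (auto simp: space_PiM)
  then have "(\<lambda>g. (\<lambda>ij\<in>{..<n} \<times> {..<n}. g $$ ij) (i, j)) \<in> borel_measurable (unitary_borel n)"
    by (rule measurable_compose[OF _ measurable_component_singleton]) (use assms in auto)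
  then have "(\<lambda>g. g $$ (i, j)) \<in> borel_measurable (unitary_borel n)"
    using assms by simp
  then show ?thesis
    using M by (simp add: haar_prob_def cong: measurable_cong_sets)
qed

lemma measurable_row_gram:
  assumes M: "haar_prob n M"
  shows "row_gram n \<gamma> J \<in> borel_measurable M"
proof -
  have rr: "(\<lambda>g. resolvent_rows \<gamma> g i j) \<in> borel_measurable M" if "i < n" "j < n" for i j
    unfolding resolvent_rows_def using measurable_entry[OF M that] by measurable
  have cnj: "(\<lambda>g. cnj (resolvent_rows \<gamma> g i j)) \<in> borel_measurable M" if "i < n" "j < n" for i j
    using rr[OF that] by (rule measurable_compose) (auto intro!: borel_measurable_continuous_onI continuous_intros)
  have gr: "(\<lambda>g. gram n (resolvent_rows \<gamma> g) i j) \<in> borel_measurable M" if "i < n" "j < n" for i j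
    unfolding gram_def using that by (intro borel_measurable_sum borel_measurable_times rr cnj) auto
  have "(\<lambda>g. principal_minor n J (gram n (resolvent_rows \<gamma> g))) \<in> borel_measurable M"
    unfolding principal_minor_leibniz
  proof (intro borel_measurable_sum borel_measurable_times borel_measurable_prod borel_measurable_const)
    fix p i assume "p \<in> {p. p permutes {0..<n}}" "i \<in> {0..<n}"
    then have "i < n" "p i < n" using permutes_in_image[of p "{0..<n}" i] by auto
    then show "(\<lambda>g. if i \<in> J then gram n (resolvent_rows \<gamma> g) i (p i) else if i = p i then 1 else 0) \<in> borel_measurable M"
      using gr by simp
  qed
  then show ?thesis unfolding row_gram_def[abs_def] by measurable
qed

lemma measurable_left_mult:
  assumes M: "haar_prob n M" and u: "u \<in> unitary_group n"
  shows "(\<lambda>g. u * g) \<in> M \<rightarrow>\<^sub>M M"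
proof -
  have sp: "space M = unitary_group n" using M by (rule space_haar_prob)
  have "(\<lambda>g. u * g) \<in> M \<rightarrow>\<^sub>M unitary_borel n"
    unfolding unitary_borel_def
  proof (rule measurable_vimage_algebra2)
    show "(\<lambda>g. u * g) \<in> space M \<rightarrow> unitary_group n" using u by (auto simp: sp unitary_group_mult)
    show "(\<lambda>g. \<lambda>ij\<in>{..<n} \<times> {..<n}. (u * g) $$ ij) \<in> M \<rightarrow>\<^sub>M (\<Pi>\<^sub>M ij\<in>{..<n} \<times> {..<n}. borel)"
    proof (rule measurable_restrict)
      fix ij assume "ij \<in> {..<n} \<times> {..<n}"
      then obtain i j where ij: "ij = (i, j)" "i < n" "j < n" by auto
      have "(\<lambda>g. \<Sum>k=0..<n. u $$ (i, k) * g $$ (k, j)) \<in> borel_measurable M"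
        using ij by (intro borel_measurable_sum borel_measurable_times borel_measurable_const measurable_entry[OF M]) auto
      then show "(\<lambda>g. (u * g) $$ ij) \<in> borel_measurable M"
        by (rule measurable_cong[THEN iffD1, rotated])
          (use ij unitary_group_carrier[OF u] in \<open>auto simp: sp scalar_prod_def dest!: unitary_group_carrier\<close>)
    qed
  qed
  then show ?thesis using M by (simp add: haar_prob_def cong: measurable_cong_sets)
qed

text \<open>\<open>haar_prob\<close> states invariance for images of sets, while a change of
  variables concerns preimages. The preimage under multiplication by \<open>u\<close> is the image
  under multiplication by its adjoint.\<close>

lemma haar_left_invariant:
  assumes M: "haar_prob n M" and u: "u \<in> unitary_group n" and f: "f \<in> borel_measurable M"
  shows "(\<integral>\<^sup>+ g. f (u * g) \<partial>M) = (\<integral>\<^sup>+ g. f g \<partial>M)"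
proof -
  have sp: "space M = unitary_group n" using M by (rule space_haar_prob)
  note T = measurable_left_mult[OF M u]
  have "distr M M (\<lambda>g. u * g) = M"
  proof (rule measure_eqI)
    fix S assume "S \<in> sets (distr M M (\<lambda>g. u * g))"
    then have S: "S \<in> sets M" by simp
    then have SU: "S \<subseteq> unitary_group n" using sets.sets_into_space sp by blast
    note uc = unitary_group_carrier[OF u] and ua = mat_adjoint_carrier[OF unitary_group_carrier[OF u]]
    have 1: "u * (mat_adjoint u * g) = g" "mat_adjoint u * (u * g) = g" if "g \<in> carrier_mat n n" for g
      using u uc ua that by (simp_all add: unitary_group_def flip: assoc_mult_mat[of _ n n _ n _ n])
    have "(\<lambda>g. u * g) -` S \<inter> space M = (\<lambda>g. mat_adjoint u * g) ` S"
    proof (intro equalityI subsetI)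
      fix g assume "g \<in> (\<lambda>g. u * g) -` S \<inter> space M"
      then have g: "u * g \<in> S" "g \<in> unitary_group n" by (auto simp: sp)
      then have "g = mat_adjoint u * (u * g)" by (simp add: 1 unitary_group_carrier)
      then show "g \<in> (\<lambda>g. mat_adjoint u * g) ` S" using g by blast
    next
      fix g assume "g \<in> (\<lambda>g. mat_adjoint u * g) ` S"
      then obtain h where h: "h \<in> S" "g = mat_adjoint u * h" by blast
      then have "h \<in> unitary_group n" using SU by blast
      then show "g \<in> (\<lambda>g. u * g) -` S \<inter> space M"
        using h by (auto simp: 1 sp unitary_group_carrier intro: unitary_group_mult unitary_group_adjoint[OF u])
    qed
    moreover have "emeasure M ((\<lambda>g. mat_adjoint u * g) ` S) = emeasure M S"
      using M S unitary_group_adjoint[OF u] by (auto simp: haar_prob_def)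
    ultimately show "emeasure (distr M M (\<lambda>g. u * g)) S = emeasure M S"
      using S T by (simp add: emeasure_distr)
  qed simp
  then have "(\<integral>\<^sup>+ g. f g \<partial>M) = (\<integral>\<^sup>+ g. f g \<partial>distr M M (\<lambda>g. u * g))" by simp
  also have "\<dots> = (\<integral>\<^sup>+ g. f (u * g) \<partial>M)" using T f by (simp add: nn_integral_distr)
  finally show ?thesis by simp
qed

text \<open>The weight \<open>\<rho>\<close> makes the induction work: it absorbs the factor \<open>G\<^sub>J / G\<^bsub>insert i J\<^esub>\<close>, which the rotations
  of the rows in \<open>I\<close> leave unchanged.\<close>

lemma haar_row_gram_ratio_le:
  assumes M: "haar_prob n M" and gam: "0 \<le> \<gamma>" "\<gamma> < 1" and I: "I \<subseteq> {0..<n}"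
    and \<rho>: "\<rho> \<in> borel_measurable M"
    and inv: "\<And>i w g. i \<in> I \<Longrightarrow> cmod w = 1 \<Longrightarrow> g \<in> unitary_group n \<Longrightarrow> \<rho> (rot n i w * g) = \<rho> g"
  shows "(\<integral>\<^sup>+ g. \<rho> g * ennreal (row_gram n \<gamma> ({0..<n} - I) g / row_gram n \<gamma> {0..<n} g) \<partial>M)
     \<le> ennreal ((2 / (1 - \<gamma>\<^sup>2)) ^ card I) * (\<integral>\<^sup>+ g. \<rho> g \<partial>M)"
proof -
  define \<kappa> where "\<kappa> = 2 / (1 - \<gamma>\<^sup>2)"
  have "\<gamma>\<^sup>2 < 1" using gam by (simp add: power_less_one_iff)
  then have \<kappa>: "\<kappa> > 0" by (simp add: \<kappa>_def)
  \<comment> \<open>The number \<open>m\<close> of roots depends on \<gamma> but does not enter the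
    final bound. Passing to \<open>Suc m0\<close> makes it positive.\<close>
  obtain m0 where "\<gamma> ^ m0 < 1/3" using real_arch_pow_inv[of "1/3" \<gamma>] gam by auto
  then have "\<gamma> ^ Suc m0 < 1/3" using gam mult_left_le_one_le[of "\<gamma> ^ m0" \<gamma>] by simp
  then obtain m where m: "m > 0" "\<gamma> ^ m \<le> 1/3" by (meson less_imp_le zero_less_Suc)
  have sp: "space M = unitary_group n" using M by (rule space_haar_prob)
  let ?G = "row_gram n \<gamma>"
  note pos = row_gram_pos[OF _ gam]
  have "finite I" using I finite_subset by blast
  then have "(\<integral>\<^sup>+ g. \<rho> g * ennreal (?G ({0..<n} - I) g / ?G {0..<n} g) \<partial>M) \<le> ennreal (\<kappa> ^ card I) * (\<integral>\<^sup>+ g. \<rho> g \<partial>M)"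
    using I \<rho> inv
  proof (induction I arbitrary: \<rho>)
    case empty
    have "(\<integral>\<^sup>+ g. \<rho> g * ennreal (?G ({0..<n} - {}) g / ?G {0..<n} g) \<partial>M) = (\<integral>\<^sup>+ g. \<rho> g \<partial>M)"
    proof (intro nn_integral_cong)
      fix g assume "g \<in> space M"
      then have "?G {0..<n} g > 0" using pos[of g n "{0..<n}"] sp by simp
      then show "\<rho> g * ennreal (?G ({0..<n} - {}) g / ?G {0..<n} g) = \<rho> g" by simp
    qed
    then show ?case by simp
  next
    case (insert i I)
    \<comment> \<open>As \<open>insert i J\<close> is the complement of \<open>I\<close>, the ratio
      for \<open>insert i I\<close> is \<open>r\<close> times the ratio for \<open>I\<close>, and
      the induction hypothesis applies with weight \<open>\<rho> * r\<close>.\<close>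
    define J where "J = {0..<n} - insert i I"
    have i: "i < n" "i \<notin> J" and J: "J \<subseteq> {0..<n}" and iJ: "insert i J = {0..<n} - I"
      using insert.hyps insert.prems(1) by (auto simp: J_def)
    define r where "r g = ennreal (?G J g / ?G (insert i J) g)" for g
    have r [measurable]: "r \<in> borel_measurable M"
      unfolding r_def using measurable_row_gram[OF M] by measurable
    note [measurable] = insert.prems(2)
    have step: "(\<integral>\<^sup>+ g. \<rho> g * r g \<partial>M) \<le> ennreal \<kappa> * (\<integral>\<^sup>+ g. \<rho> g \<partial>M)"
    proof -
      let ?D = "\<lambda>k. rot n i (cis (2 * pi * real k / real m))"
      have D: "?D k \<in> unitary_group n" for k by (rule rot_unitary) simp
      \<comment> \<open>Each of the \<open>m\<close> copies of the integral is shifted by a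
        different rotation of row \<open>i\<close>. These leave \<rho> unchanged, so the
        roots-of-unity bound applies pointwise to the sum.\<close>
      have "of_nat m * (\<integral>\<^sup>+ g. \<rho> g * r g \<partial>M) = (\<Sum>k<m. \<integral>\<^sup>+ g. \<rho> g * r g \<partial>M)" by simp
      also have "\<dots> = (\<Sum>k<m. \<integral>\<^sup>+ g. \<rho> (?D k * g) * r (?D k * g) \<partial>M)"
        by (intro sum.cong refl haar_left_invariant[OF M D, symmetric]) measurable
      also have "\<dots> = (\<Sum>k<m. \<integral>\<^sup>+ g. \<rho> g * r (?D k * g) \<partial>M)"
        by (intro sum.cong refl nn_integral_cong) (simp add: insert.prems(3) sp)
      also have "\<dots> = (\<integral>\<^sup>+ g. (\<Sum>k<m. \<rho> g * r (?D k * g)) \<partial>M)"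
      proof (rule nn_integral_sum[symmetric])
        fix k
        have "(\<lambda>g. \<rho> (?D k * g) * r (?D k * g)) \<in> borel_measurable M"
          using measurable_left_mult[OF M D] by measurable
        then show "(\<lambda>g. \<rho> g * r (?D k * g)) \<in> borel_measurable M"
          by (rule measurable_cong[THEN iffD1, rotated]) (simp add: insert.prems(3) sp)
      qed
      also have "\<dots> \<le> (\<integral>\<^sup>+ g. ennreal (real m * \<kappa>) * \<rho> g \<partial>M)"
      proof (intro nn_integral_mono)
        fix g assume "g \<in> space M"
        then have g: "g \<in> unitary_group n" by (simp add: sp)
        have "(\<Sum>k<m. r (?D k * g)) = ennreal (\<Sum>k<m. ?G J g / ?G (insert i J) (?D k * g))"
          using row_gram_nonneg row_gram_rot[OF unitary_group_carrier[OF g] i(2) J]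
          by (subst sum_ennreal[symmetric]) (auto simp: r_def)
        also have "\<dots> \<le> ennreal (real m * \<kappa>)"
          unfolding \<kappa>_def by (intro ennreal_leI row_gram_rot_average_le[OF g i J gam m])
        finally show "(\<Sum>k<m. \<rho> g * r (?D k * g)) \<le> ennreal (real m * \<kappa>) * \<rho> g"
          by (simp add: sum_distrib_left[symmetric] mult.commute mult_left_mono)
      qed
      also have "\<dots> = of_nat m * (ennreal \<kappa> * (\<integral>\<^sup>+ g. \<rho> g \<partial>M))"
        using \<kappa> by (simp add: nn_integral_cmult ennreal_mult mult.assoc ennreal_of_nat_eq_real_of_nat)
      finally show ?thesis
        using m by (subst (asm) ennreal_mult_le_mult_iff) (auto)
    qed
    have "(\<integral>\<^sup>+ g. \<rho> g * ennreal (?G J g / ?G {0..<n} g) \<partial>M) =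
      (\<integral>\<^sup>+ g. \<rho> g * r g * ennreal (?G ({0..<n} - I) g / ?G {0..<n} g) \<partial>M)"
    proof (intro nn_integral_cong)
      fix g assume "g \<in> space M"
      then have g: "?G J g > 0" "?G (insert i J) g > 0" "?G {0..<n} g > 0"
        using pos[of g n] sp J i by auto
      have "ennreal (?G J g / ?G {0..<n} g) = ennreal (?G J g / ?G (insert i J) g * (?G (insert i J) g / ?G {0..<n} g))"
        using g by simp
      also have "\<dots> = r g * ennreal (?G ({0..<n} - I) g / ?G {0..<n} g)"
        using g unfolding r_def iJ[symmetric] by (intro ennreal_mult) auto
      finally show "\<rho> g * ennreal (?G J g / ?G {0..<n} g) = \<rho> g * r g * ennreal (?G ({0..<n} - I) g / ?G {0..<n} g)"
        by (simp add: mult.assoc)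
    qed
    also have "\<dots> \<le> ennreal (\<kappa> ^ card I) * (\<integral>\<^sup>+ g. \<rho> g * r g \<partial>M)"
    proof (rule insert.IH)
      fix l w g assume "l \<in> I" "cmod w = 1" and g: "g \<in> unitary_group n"
      moreover have "?G J (rot n l w * g) = ?G J g" "?G (insert i J) (rot n l w * g) = ?G (insert i J) g"
        using \<open>l \<in> I\<close> insert.hyps J i
        by (auto intro!: row_gram_rot[OF unitary_group_carrier[OF g]] simp: J_def)
      ultimately show "\<rho> (rot n l w * g) * r (rot n l w * g) = \<rho> g * r g"
        using insert.prems(3)[of l w g] by (simp add: r_def)
    qed (use insert.prems in \<open>auto\<close>)
    also have "\<dots> \<le> ennreal (\<kappa> ^ card I) * (ennreal \<kappa> * (\<integral>\<^sup>+ g. \<rho> g \<partial>M))"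
      by (rule mult_left_mono[OF step]) simp
    also have "\<dots> =
        ennreal (\<kappa> ^ card (insert i I)) * (\<integral>\<^sup>+ g. \<rho> g \<partial>M)"
      using insert.hyps \<kappa> by (simp add: ennreal_mult mult_ac)
    finally show ?case unfolding J_def .
  qed
  then show ?thesis by (simp add: \<kappa>_def)
qed

section \<open>Eigenvalues of unitary matrices\<close>

lemma det_char_mat_eq_prod_list:
  fixes A :: "complex mat"
  assumes A: "A \<in> carrier_mat n n" and as: "char_poly A = (\<Prod>a\<leftarrow>as. [:- a, 1:])"
  shows "det (mat n n (\<lambda>(i, j). (if i = j then r else 0) - A $$ (i, j))) = (\<Prod>a\<leftarrow>as. r - a)"
proof -
  have "mat n n (\<lambda>(i, j). (if i = j then r else 0) - A $$ (i, j)) = - char_matrix A r"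
    using A by (intro eq_matI) (auto simp: char_matrix_def)
  then have "det (mat n n (\<lambda>(i, j). (if i = j then r else 0) - A $$ (i, j))) = poly (char_poly A) r"
    by (simp add: char_poly_matrix[OF A])
  then show ?thesis unfolding as by (simp add: poly_prod_list o_def)
qed

lemma unitary_eigenvalue_norm:
  assumes g: "g \<in> unitary_group n" and a: "poly (char_poly g) a = 0"
  shows "cmod a = 1"
proof -
  have gc: "g \<in> carrier_mat n n" using g by (simp add: unitary_group_def)
  then have "eigenvalue g a" using a eigenvalue_root_char_poly by blast
  then obtain v where v: "v \<in> carrier_vec n" "v \<noteq> 0\<^sub>v n" and ve: "g *\<^sub>v v = a \<cdot>\<^sub>v v"
    unfolding eigenvalue_def eigenvector_def using gc by auto
  have gv: "(\<Sum>k=0..<n. g $$ (l, k) * v $ k) = a * v $ l" if "l < n" for l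
  proof -
    have "(g *\<^sub>v v) $ l = a * v $ l" unfolding ve using v(1) that by simp
    then show ?thesis using gc v(1) that by (simp add: scalar_prod_def)
  qed
  obtain i where "i < n" "v $ i \<noteq> 0"
    using v by (metis eq_vecI carrier_vecD index_zero_vec)
  then have S: "(\<Sum>k=0..<n. (cmod (v $ k))\<^sup>2) > 0" by (intro sum_pos2[of _ i]) auto
  have "(\<Sum>l=0..<n. (cmod (a * v $ l))\<^sup>2) = (\<Sum>k=0..<n. (cmod (v $ k))\<^sup>2)"
    using unitary_norm_preserving[OF g, of "\<lambda>k. v $ k"] by (simp add: gv)
  then have "(cmod a)\<^sup>2 * (\<Sum>k=0..<n. (cmod (v $ k))\<^sup>2) = (\<Sum>k=0..<n. (cmod (v $ k))\<^sup>2)"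
    by (simp add: norm_mult power_mult_distrib sum_distrib_left)
  then have "(cmod a)\<^sup>2 = 1" using S by simp
  then show ?thesis using power2_eq_iff_nonneg[of "cmod a" 1] by simp
qed

section \<open>The product over eigenvalues as a sum of Gram ratios\<close>

lemma prod_list_map_mult:
  "(\<Prod>a\<leftarrow>as. f a * h a) = (\<Prod>a\<leftarrow>as. f a) * (\<Prod>a\<leftarrow>as. h a :: 'a :: comm_monoid_mult)"
  by (induction as) (auto simp: mult_ac)

lemma of_real_prod_list_map:
  "of_real (\<Prod>a\<leftarrow>as. f a) = (\<Prod>a\<leftarrow>as. of_real (f a) :: 'a :: {real_algebra_1, comm_monoid_mult})"
  by (induction as) auto

text \<open>Orthonormality of the rows of \<open>g\<close> reduces the quadratic term of
  \<open>Y Y^*\<close> to a multiple of the identity.\<close>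

lemma gram_resolvent_rows:
  assumes g: "g \<in> unitary_group n" and "i < n" "j < n"
  shows "gram n (resolvent_rows \<gamma> g) i j =
    (if i = j then 1 + of_real (\<gamma>\<^sup>2) else 0) - of_real \<gamma> * g $$ (i, j) - of_real \<gamma> * cnj (g $$ (j, i))"
proof -
  have "gram n (resolvent_rows \<gamma> g) i j = (\<Sum>k=0..<n. (if i = k then (if j = k then 1 else 0) else 0))
      - of_real \<gamma> * (\<Sum>k=0..<n. if j = k then g $$ (i, k) else 0)
      - of_real \<gamma> * (\<Sum>k=0..<n. if i = k then cnj (g $$ (j, k)) else 0)
      + of_real \<gamma> * of_real \<gamma> * (\<Sum>k=0..<n. g $$ (i, k) * cnj (g $$ (j, k)))"
    unfolding gram_def resolvent_rows_def sum_distrib_left sum_subtractf[symmetric] sum.distrib[symmetric]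
    by (intro sum.cong refl) (auto simp: algebra_simps)
  also have "(\<Sum>k=0..<n. g $$ (i, k) * cnj (g $$ (j, k))) = (if i = j then 1 else 0)"
    using assms by (simp add: unitary_group_iff)
  finally show ?thesis using assms by (simp add: power2_eq_square)
qed

text \<open>For unitary \<open>g\<close> the matrix \<open>b + (1 - \<gamma>g)(1 - \<gamma>g)\<^sup>*\<close>, multiplied by \<open>g\<close>, is a quadratic polynomial
  in \<open>g\<close>, so its determinant is read off the characteristic polynomial.\<close>

lemma det_gram_resolvent_rows:
  assumes g: "g \<in> unitary_group n" and as: "char_poly g = (\<Prod>a\<leftarrow>as. [:- a, 1:])" "length as = n"
    and gam: "\<gamma> > 0"
  shows "det (mat n n (\<lambda>(i, j). gram n (resolvent_rows \<gamma> g) i j + (if i = j then of_real b else 0))) =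
    of_real (\<Prod>a\<leftarrow>as. b + (cmod (1 - of_real \<gamma> * a))\<^sup>2)"
proof -
  have gc: "g \<in> carrier_mat n n" using g by (simp add: unitary_group_def)
  define s :: complex where "s = 1 + of_real (\<gamma>\<^sup>2) + of_real b"
  \<comment> \<open>\<open>r1\<close> and \<open>r2\<close> will be the roots of
    \<open>t^2 - (s / \<gamma>) t + 1\<close>. With \<open>P = s - \<gamma> g - \<gamma> g^*\<close>
    and \<open>g^* g = 1\<close> this yields
    \<open>P g = - \<gamma> (r1 - g) (r2 - g)\<close>.\<close>
  define d where "d = csqrt ((s / of_real \<gamma>)\<^sup>2 - 4)"
  define r1 where "r1 = (s / of_real \<gamma> + d) / 2"
  define r2 where "r2 = (s / of_real \<gamma> - d) / 2"
  have d2: "d\<^sup>2 = (s / of_real \<gamma>)\<^sup>2 - 4" by (simp add: d_def)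
  have sum: "of_real \<gamma> * (r1 + r2) = s" using gam by (simp add: r1_def r2_def field_simps)
  have "r1 * r2 = ((s / of_real \<gamma>)\<^sup>2 - d\<^sup>2) / 4"
    by (simp add: r1_def r2_def power2_eq_square algebra_simps)
  then have prod: "r1 * r2 = 1" by (simp add: d2)
  define P where "P = mat n n (\<lambda>(i, j). gram n (resolvent_rows \<gamma> g) i j + (if i = j then of_real b else 0))"
  define C where "C r = mat n n (\<lambda>(i, j). (if i = j then r else 0) - g $$ (i, j))" for r
  have carr: "P \<in> carrier_mat n n" "\<And>r. C r \<in> carrier_mat n n" by (simp_all add: P_def C_def)
  have P: "P $$ (i, j) = (if i = j then s else 0) - of_real \<gamma> * g $$ (i, j) - of_real \<gamma> * cnj (g $$ (j, i))"
    if "i < n" "j < n" for i j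
    using that by (simp add: P_def gram_resolvent_rows[OF g] s_def)
  have "P * g = (- of_real \<gamma>) \<cdot>\<^sub>m (C r1 * C r2)"
  proof (rule eq_matI)
    fix i j assume "i < dim_row ((- of_real \<gamma>) \<cdot>\<^sub>m (C r1 * C r2))" "j < dim_col ((- of_real \<gamma>) \<cdot>\<^sub>m (C r1 * C r2))"
    then have ij: "i < n" "j < n" using carr(2)[of r1] carr(2)[of r2] by auto
    define Q where "Q = (\<Sum>k=0..<n. g $$ (i, k) * g $$ (k, j))"
    have "(P * g) $$ (i, j) = (\<Sum>k=0..<n. ((if i = k then s else 0) - of_real \<gamma> * g $$ (i, k) - of_real \<gamma> * cnj (g $$ (k, i))) * g $$ (k, j))"
      using ij carr gc by (simp add: scalar_prod_def P)
    also have "\<dots> = (\<Sum>k=0..<n. if i = k then s * g $$ (k, j) else 0) - of_real \<gamma> * Q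
        - of_real \<gamma> * (\<Sum>k=0..<n. cnj (g $$ (k, i)) * g $$ (k, j))"
      unfolding sum_distrib_left sum_subtractf[symmetric] Q_def
      by (intro sum.cong refl) (auto simp: algebra_simps)
    also have "(\<Sum>k=0..<n. cnj (g $$ (k, i)) * g $$ (k, j)) = (if i = j then 1 else 0)"
      using g ij by (simp add: unitary_group_iff)
    finally have L: "(P * g) $$ (i, j) = s * g $$ (i, j) - of_real \<gamma> * Q - of_real \<gamma> * (if i = j then 1 else 0)"
      using ij by simp
    have "(C r1 * C r2) $$ (i, j) = (\<Sum>k=0..<n. ((if i = k then r1 else 0) - g $$ (i, k)) * ((if k = j then r2 else 0) - g $$ (k, j)))"
      using ij carr by (simp add: scalar_prod_def C_def)
    also have "\<dots> = (\<Sum>k=0..<n. if i = k then r1 * (if k = j then r2 else 0) else 0) - (\<Sum>k=0..<n. if i = k then r1 * g $$ (k, j) else 0)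
       - (\<Sum>k=0..<n. if k = j then r2 * g $$ (i, k) else 0) + Q"
      unfolding sum_subtractf[symmetric] sum.distrib[symmetric] Q_def
      by (intro sum.cong refl) (auto simp: algebra_simps)
    also have "\<dots> = (if i = j then 1 else 0) - (r1 + r2) * g $$ (i, j) + Q"
      using ij prod by (simp add: algebra_simps)
    finally have "((- of_real \<gamma>) \<cdot>\<^sub>m (C r1 * C r2)) $$ (i, j) =
      - of_real \<gamma> * ((if i = j then 1 else 0) - (r1 + r2) * g $$ (i, j) + Q)"
      using ij carr(2)[of r1] carr(2)[of r2] by (subst index_smult_mat) auto
    also have "\<dots> = (P * g) $$ (i, j)" unfolding L sum[symmetric] by (simp add: algebra_simps)
    finally show "(P * g) $$ (i, j) = ((- of_real \<gamma>) \<cdot>\<^sub>m (C r1 * C r2)) $$ (i, j)" by simp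
  qed (use carr(1) carr(2)[of r1] carr(2)[of r2] gc in auto)
  then have "det (P * g) = (- of_real \<gamma>) ^ n * det (C r1 * C r2)"
    using carr(2)[of r2] by simp
  then have "det P * det g = (- of_real \<gamma>) ^ n * (det (C r1) * det (C r2))"
    unfolding det_mult[OF carr(1) gc] det_mult[OF carr(2) carr(2)] .
  also have "\<dots> = (- of_real \<gamma>) ^ length as * ((\<Prod>a\<leftarrow>as. r1 - a) * (\<Prod>a\<leftarrow>as. r2 - a))"
    unfolding C_def det_char_mat_eq_prod_list[OF gc as(1)] as(2) ..
  also have "\<dots> = (\<Prod>a\<leftarrow>as. - of_real \<gamma> * ((r1 - a) * (r2 - a)))"
    by (induction as) (auto simp: mult_ac)
  \<comment> \<open>On the unit circle \<open>cnj a\<close> is the inverse of \<open>a\<close>, so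
    the scalar factors obey the same quadratic identity as the matrices.\<close>
  also have "\<dots> = (\<Prod>a\<leftarrow>as. of_real (b + (cmod (1 - of_real \<gamma> * a))\<^sup>2) * a)"
  proof (intro arg_cong[where f = prod_list] map_cong refl)
    fix a assume "a \<in> set as"
    then have "poly (char_poly g) a = 0"
      unfolding as by (auto simp: poly_prod_list o_def prod_list_zero_iff)
    then have "cmod a = 1" by (rule unitary_eigenvalue_norm[OF g])
    then have aa: "a * cnj a = 1" using complex_norm_square[of a] by simp
    have "of_real (b + (cmod (1 - of_real \<gamma> * a))\<^sup>2) = of_real b + (1 - of_real \<gamma> * a) * cnj (1 - of_real \<gamma> * a)"
      by (simp only: of_real_add complex_norm_square)
    also have "\<dots> = of_real b + 1 - of_real \<gamma> * a - of_real \<gamma> * cnj a + of_real (\<gamma>\<^sup>2) * (a * cnj a)"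
      by (simp add: algebra_simps power2_eq_square)
    also have "\<dots> = s - of_real \<gamma> * a - of_real \<gamma> * cnj a" by (simp add: aa s_def)
    finally have "of_real (b + (cmod (1 - of_real \<gamma> * a))\<^sup>2) * a = (s - of_real \<gamma> * a - of_real \<gamma> * cnj a) * a"
      by (rule arg_cong)
    also have "\<dots> = s * a - of_real \<gamma> * (a * a) - of_real \<gamma> * (a * cnj a)"
      by (simp add: algebra_simps)
    also have "\<dots> = of_real \<gamma> * (r1 + r2) * a - of_real \<gamma> * (a * a) - of_real \<gamma> * (r1 * r2)"
      by (simp add: aa prod sum)
    also have "\<dots> = - of_real \<gamma> * ((r1 - a) * (r2 - a))" by (simp add: algebra_simps)
    finally show "- of_real \<gamma> * ((r1 - a) * (r2 - a)) = of_real (b + (cmod (1 - of_real \<gamma> * a))\<^sup>2) * a" ..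
  qed
  also have "\<dots> = of_real (\<Prod>a\<leftarrow>as. b + (cmod (1 - of_real \<gamma> * a))\<^sup>2) * det g"
    unfolding det_eq_prod_list_eigenvalues[OF gc as] prod_list_map_mult of_real_prod_list_map
    by simp
  finally have eq: "det P * det g = of_real (\<Prod>a\<leftarrow>as. b + (cmod (1 - of_real \<gamma> * a))\<^sup>2) * det g" .
  \<comment> \<open>Eigenvalues of modulus 1 make \<open>det g\<close> nonzero, so it can be
    cancelled.\<close>
  have "0 \<notin> set as"
  proof
    assume "0 \<in> set as"
    then have "poly (char_poly g) 0 = 0"
      unfolding as by (auto simp: poly_prod_list o_def prod_list_zero_iff)
    then show False using unitary_eigenvalue_norm[OF g] by fastforce
  qed
  then have "det g \<noteq> 0" unfolding det_eq_prod_list_eigenvalues[OF gc as] by (simp add: prod_list_zero_iff)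
  then show ?thesis using eq by (simp add: P_def)
qed

lemma prod_list_resolvent_eq_sum_row_gram:
  assumes g: "g \<in> unitary_group n" and as: "char_poly g = (\<Prod>a\<leftarrow>as. [:- a, 1:])" "length as = n"
    and gam: "0 < \<gamma>" "\<gamma> < 1"
  shows "(\<Prod>a\<leftarrow>as. 1 + b / (cmod (1 - of_real \<gamma> * a))\<^sup>2) =
    (\<Sum>J\<in>Pow {0..<n}. b ^ (n - card J) * (row_gram n \<gamma> J g / row_gram n \<gamma> {0..<n} g))"
proof -
  let ?H = "gram n (resolvent_rows \<gamma> g)"
  have "of_real (\<Prod>a\<leftarrow>as. b + (cmod (1 - of_real \<gamma> * a))\<^sup>2) =
     (\<Sum>J\<in>Pow {0..<n}. of_real b ^ (n - card J) * principal_minor n J ?H)"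
    using det_gram_resolvent_rows[OF g as gam(1), of b] det_add_diag_expand[of n ?H "of_real b"] by simp
  then have "Re (of_real (\<Prod>a\<leftarrow>as. b + (cmod (1 - of_real \<gamma> * a))\<^sup>2)) =
     (\<Sum>J\<in>Pow {0..<n}. Re (of_real (b ^ (n - card J)) * principal_minor n J ?H))"
    by (simp only: Re_sum of_real_power)
  then have 1: "(\<Prod>a\<leftarrow>as. b + (cmod (1 - of_real \<gamma> * a))\<^sup>2) = (\<Sum>J\<in>Pow {0..<n}. b ^ (n - card J) * row_gram n \<gamma> J g)"
    by (simp add: row_gram_def del: of_real_power)
  \<comment> \<open>The full Gram determinant is the case \<open>b = 0\<close> of the same
    eigenvalue formula.\<close>
  have "minor_mat n {0..<n} ?H = mat n n (\<lambda>(i, j). ?H i j + (if i = j then of_real 0 else 0))"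
    unfolding minor_mat_def by (intro cong_mat) auto
  then have 2: "row_gram n \<gamma> {0..<n} g = (\<Prod>a\<leftarrow>as. (cmod (1 - of_real \<gamma> * a))\<^sup>2)"
    using det_gram_resolvent_rows[OF g as gam(1), of 0] by (simp add: row_gram_def principal_minor_def)
  have pos: "(cmod (1 - of_real \<gamma> * a))\<^sup>2 > 0" if "a \<in> set as" for a
  proof -
    have "poly (char_poly g) a = 0"
      unfolding as using that by (auto simp: poly_prod_list o_def prod_list_zero_iff)
    then have "cmod a = 1" by (rule unitary_eigenvalue_norm[OF g])
    then have "cmod (of_real \<gamma> * a) < 1" using gam by (simp add: norm_mult)
    then have "of_real \<gamma> * a \<noteq> 1" by auto
    then show ?thesis by simp
  qed
  have "(\<Prod>a\<leftarrow>as. 1 + b / (cmod (1 - of_real \<gamma> * a))\<^sup>2) * (\<Prod>a\<leftarrow>as. (cmod (1 - of_real \<gamma> * a))\<^sup>2)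
     = (\<Prod>a\<leftarrow>as. b + (cmod (1 - of_real \<gamma> * a))\<^sup>2)"
    unfolding prod_list_map_mult[symmetric]
    using pos by (intro arg_cong[where f = prod_list] map_cong refl) (force simp: field_simps)
  moreover have "(\<Prod>a\<leftarrow>as. (cmod (1 - of_real \<gamma> * a))\<^sup>2) \<noteq> 0"
    using pos by (force simp: prod_list_zero_iff)
  ultimately have "(\<Prod>a\<leftarrow>as. 1 + b / (cmod (1 - of_real \<gamma> * a))\<^sup>2) =
     (\<Prod>a\<leftarrow>as. b + (cmod (1 - of_real \<gamma> * a))\<^sup>2) / row_gram n \<gamma> {0..<n} g"
    unfolding 2 by (simp add: field_simps)
  then show ?thesis unfolding 1 by (simp add: sum_divide_distrib)
qed

section \<open>Comparison of the periodized Cauchy kernel with the resolvent\<close>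

text \<open>Raising \<open>V\<close> by one adds the two shifts of size \<open>V + 1\<close>. Each
  is bounded by a telescoping difference, and the accumulated differences form the last factor,
  which is 0 at \<open>V = 0\<close>.\<close>

lemma periodized_cauchy_sum_le:
  fixes \<theta> :: real
  assumes N: "N \<ge> (1::nat)" and \<theta>: "- 1/2 \<le> \<theta>" "\<theta> \<le> 1/2"
  shows "(\<Sum>\<nu> = - int V..int V. 1 / (1 + (real N * (\<theta> + real_of_int \<nu>))\<^sup>2))
    \<le> 1 / (1 + (real N * \<theta>)\<^sup>2) + 16 / (real N)\<^sup>2 * (1 - 1 / (real V + 1))"
proof (induction V)
  case (Suc V)
  let ?f = "\<lambda>\<nu>::int. 1 / (1 + (real N * (\<theta> + real_of_int \<nu>))\<^sup>2)"
  define v where "v = int V + 1"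
  have summand: "?f \<nu> \<le> 8 / (real N)\<^sup>2 * (1 / (real V + 1) - 1 / (real V + 2))" if "\<bar>\<nu>\<bar> = v" for \<nu>
  proof -
    have "real V + 1/2 \<le> \<bar>\<theta> + real_of_int \<nu>\<bar>"
      using that \<theta> by (auto simp: v_def abs_if split: if_splits)
    then have "(real V + 1/2)\<^sup>2 \<le> (\<theta> + real_of_int \<nu>)\<^sup>2"
      by (metis abs_ge_zero add_nonneg_nonneg of_nat_0_le_iff power2_abs power_mono zero_le_divide_1_iff zero_le_numeral)
    \<comment> \<open>At \<open>V = 0\<close> this is an equality, which fixes the constant 8; the
      two shifts together give 16.\<close>
    moreover have "(real V + 1) * (real V + 2) / 8 \<le> (real V + 1/2)\<^sup>2"
      by (simp add: power2_eq_square field_simps)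
    ultimately have "(real V + 1) * (real V + 2) / 8 \<le> (\<theta> + real_of_int \<nu>)\<^sup>2" by linarith
    then have "(real N)\<^sup>2 * ((real V + 1) * (real V + 2) / 8) \<le> 1 + (real N * (\<theta> + real_of_int \<nu>))\<^sup>2"
      using mult_left_mono[of "(real V + 1) * (real V + 2) / 8" "(\<theta> + real_of_int \<nu>)\<^sup>2" "(real N)\<^sup>2"]
      unfolding power_mult_distrib by simp
    then have "?f \<nu> \<le> 1 / ((real N)\<^sup>2 * ((real V + 1) * (real V + 2) / 8))"
      using N by (intro divide_left_mono mult_pos_pos add_pos_nonneg) auto
    also have "\<dots> = 8 / (real N)\<^sup>2 * (1 / (real V + 1) - 1 / (real V + 2))"
      by (simp add: diff_frac_eq)
    finally show ?thesis .
  qed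
  have "{- int (Suc V)..int (Suc V)} = insert v (insert (- v) {- int V..int V})"
    by (auto simp: v_def)
  then have "(\<Sum>\<nu> = - int (Suc V)..int (Suc V). ?f \<nu>) = ?f v + (?f (- v) + (\<Sum>\<nu> = - int V..int V. ?f \<nu>))"
    by (simp add: v_def)
  also have "\<dots> \<le> 8 / (real N)\<^sup>2 * (1 / (real V + 1) - 1 / (real V + 2))
     + (8 / (real N)\<^sup>2 * (1 / (real V + 1) - 1 / (real V + 2))
     + (1 / (1 + (real N * \<theta>)\<^sup>2) + 16 / (real N)\<^sup>2 * (1 - 1 / (real V + 1))))"
    by (intro add_mono summand Suc.IH) (auto simp: v_def)
  also have "\<dots> = 1 / (1 + (real N * \<theta>)\<^sup>2) + 16 / (real N)\<^sup>2 * (1 - 1 / (real (Suc V) + 1))"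
    by (simp add: algebra_simps add_divide_distrib diff_divide_distrib)
  finally show ?case .
qed simp

text \<open>The shifted terms are absorbed into the central one: \<open>1 + (N\<theta>)^2\<close> is
  at most \<open>5/4 * N^2\<close>, so \<open>16 / N^2\<close> costs 20 copies of the central term,
  and 21 = 1 + 20.\<close>

lemma periodized_cauchy_sum_le':
  fixes \<theta> :: real
  assumes N: "N \<ge> (1::nat)" and \<theta>: "- 1/2 \<le> \<theta>" "\<theta> \<le> 1/2"
  shows "(\<Sum>\<nu> = - int V..int V. 1 / (1 + (real N * (\<theta> + real_of_int \<nu>))\<^sup>2)) \<le> 21 / (1 + (real N * \<theta>)\<^sup>2)"
proof -
  have "\<bar>\<theta>\<bar> \<le> 1/2" using \<theta> by (auto simp: abs_if)
  then have "\<theta>\<^sup>2 \<le> (1/2)\<^sup>2" by (metis abs_ge_zero power2_abs power_mono)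
  then have "(real N * \<theta>)\<^sup>2 \<le> (real N)\<^sup>2 / 4"
    using mult_left_mono[of "\<theta>\<^sup>2" "(1/2)\<^sup>2" "(real N)\<^sup>2"] by (simp add: power_mult_distrib power_divide)
  moreover have N1: "1 \<le> (real N)\<^sup>2" using N by simp
  ultimately have "1 + (real N * \<theta>)\<^sup>2 \<le> 5/4 * (real N)\<^sup>2" by simp
  then have "16 / (real N)\<^sup>2 \<le> 20 / (1 + (real N * \<theta>)\<^sup>2)"
    using N1 by (simp add: divide_simps add_pos_nonneg)
  moreover have "16 / (real N)\<^sup>2 * (1 - 1 / (real V + 1)) \<le> 16 / (real N)\<^sup>2 * 1"
    by (intro mult_left_mono) auto
  ultimately show ?thesis using periodized_cauchy_sum_le[OF assms, of V]
    by (simp add: field_simps)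
qed

lemma proots_prod_linear: "proots (\<Prod>a\<leftarrow>as. [:- a, 1:]) = mset (as :: complex list)"
proof (induction as)
  case (Cons a as)
  have "(\<Prod>a\<leftarrow>as. [:- a, 1:]) \<noteq> 0" by (auto simp: prod_list_zero_iff)
  then show ?case using Cons by (simp add: proots_mult del: mult_pCons_left mult_pCons_right)
qed simp

lemma eigenangle_props:
  assumes "cmod z = 1"
  shows "- 1/2 \<le> eigenangle z" "eigenangle z < 1/2" "cis (2 * pi * eigenangle z) = z"
  using theI'[OF eigenangle_ex1[OF assms]] by (auto simp: eigenangle_def)

text \<open>The partial sums increase in \<open>V\<close> and are bounded, so they converge. Hence
  \<open>lim\<close> is a genuine limit and inherits their bound.\<close>

lemma linear_stat_cauchy_le:
  assumes N: "N \<ge> 1" and as: "char_poly g = (\<Prod>a\<leftarrow>as. [:- a, 1:])" and n1: "\<And>a. a \<in> set as \<Longrightarrow> cmod a = 1"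
  shows "linear_stat N (\<lambda>\<xi>. 1 / (1 + \<xi>\<^sup>2)) g \<le> (\<Sum>a\<leftarrow>as. 21 / (1 + (real N * eigenangle a)\<^sup>2))"
proof -
  define S where "S V = (\<Sum>a\<leftarrow>as. \<Sum>\<nu> = - int V..int V. 1 / (1 + (real N * (eigenangle a + real_of_int \<nu>))\<^sup>2))" for V
  have "linear_stat N (\<lambda>\<xi>. 1 / (1 + \<xi>\<^sup>2)) g = lim S"
    unfolding linear_stat_def eigenangles_def as proots_prod_linear S_def
    by (simp add: multiset.map_comp o_def flip: sum_mset_sum_list mset_map)
  moreover have inc: "incseq S"
    unfolding incseq_def S_def
    by (intro allI impI sum_list_mono sum_mono2) auto
  moreover have bd: "S V \<le> (\<Sum>a\<leftarrow>as. 21 / (1 + (real N * eigenangle a)\<^sup>2))" for V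
    unfolding S_def
  proof (intro sum_list_mono)
    fix a assume "a \<in> set as"
    then have "cmod a = 1" by (rule n1)
    from eigenangle_props[OF this] N
    show "(\<Sum>\<nu> = - int V..int V. 1 / (1 + (real N * (eigenangle a + real_of_int \<nu>))\<^sup>2)) \<le> 21 / (1 + (real N * eigenangle a)\<^sup>2)"
      by (intro periodized_cauchy_sum_le') auto
  qed
  ultimately show ?thesis
    using incseq_convergent[OF inc, of "(\<Sum>a\<leftarrow>as. 21 / (1 + (real N * eigenangle a)\<^sup>2))"]
    by (metis LIMSEQ_le_const2 limI)
qed

text \<open>For \<theta> the eigenangle of \<open>a\<close>, \<open>|1 - \<gamma>a|^2 = (1 -
  \<gamma>)^2 + 4 \<gamma> sin^2(pi \<theta>)\<close>, where \<open>1 - \<gamma> = 1 / (2N)\<close>.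
  Bounding the sine by its argument and \<open>pi^2\<close> by 10 gives
  \<open>1 + 160 (N\<theta>)^2\<close> after multiplication by \<open>4 N^2\<close>.\<close>

lemma cauchy_le_resolvent:
  assumes N: "N \<ge> (1::nat)" and a: "cmod a = 1"
  shows "1 / (1 + (real N * eigenangle a)\<^sup>2) \<le> 160 * (1 / (4 * (real N)\<^sup>2) / (cmod (1 - of_real (1 - 1 / (2 * real N)) * a))\<^sup>2)"
proof -
  define \<gamma> where "\<gamma> = 1 - 1 / (2 * real N)"
  define \<theta> where "\<theta> = eigenangle a"
  have gam: "0 < \<gamma>" "\<gamma> < 1" using N by (auto simp: \<gamma>_def field_simps)
  have a_eq: "a = cis (2 * pi * \<theta>)" using eigenangle_props[OF a] by (simp add: \<theta>_def)
  have expand: "(1 - \<gamma> * c)\<^sup>2 + (\<gamma> * s)\<^sup>2 = 1 - 2 * \<gamma> * c + \<gamma>\<^sup>2 * (s\<^sup>2 + c\<^sup>2)" for c s :: real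
    by (simp add: power2_eq_square algebra_simps)
  have "(cmod (1 - of_real \<gamma> * a))\<^sup>2 = (1 - \<gamma> * cos (2 * pi * \<theta>))\<^sup>2 + (\<gamma> * sin (2 * pi * \<theta>))\<^sup>2"
    by (simp add: a_eq cmod_power2)
  also have "\<dots> = 1 - 2 * \<gamma> * cos (2 * pi * \<theta>) + \<gamma>\<^sup>2 * ((sin (2 * pi * \<theta>))\<^sup>2 + (cos (2 * pi * \<theta>))\<^sup>2)"
    by (rule expand)
  also have "\<dots> = (1 - \<gamma>)\<^sup>2 + 2 * \<gamma> * (1 - cos (2 * (pi * \<theta>)))"
    unfolding sin_cos_squared_add by (simp add: power2_eq_square algebra_simps)
  also have "1 - cos (2 * (pi * \<theta>)) = 2 * (sin (pi * \<theta>))\<^sup>2"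
    by (simp add: cos_double_sin)
  finally have eq: "(cmod (1 - of_real \<gamma> * a))\<^sup>2 = (1 - \<gamma>)\<^sup>2 + 4 * \<gamma> * (sin (pi * \<theta>))\<^sup>2" by simp
  have "(sin (pi * \<theta>))\<^sup>2 \<le> (pi * \<theta>)\<^sup>2"
    using abs_sin_x_le_abs_x[of "pi * \<theta>"] by (simp add: abs_le_square_iff)
  also have "\<dots> \<le> 10 * \<theta>\<^sup>2"
  proof -
    have "pi\<^sup>2 \<le> (3.15)\<^sup>2" using pi_approx by (intro power_mono) auto
    then have "pi\<^sup>2 \<le> 10" by (simp add: power2_eq_square)
    then show ?thesis by (simp add: power_mult_distrib mult_right_mono)
  qed
  finally have "4 * \<gamma> * (sin (pi * \<theta>))\<^sup>2 \<le> 4 * 1 * (10 * \<theta>\<^sup>2)"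
    using gam by (intro mult_mono) auto
  then have "(cmod (1 - of_real \<gamma> * a))\<^sup>2 \<le> (1 - \<gamma>)\<^sup>2 + 40 * \<theta>\<^sup>2" unfolding eq by simp
  then have "4 * (real N)\<^sup>2 * (cmod (1 - of_real \<gamma> * a))\<^sup>2 \<le> 4 * (real N)\<^sup>2 * ((1 - \<gamma>)\<^sup>2 + 40 * \<theta>\<^sup>2)"
    by (intro mult_left_mono) auto
  also have "\<dots> = 1 + 160 * (real N * \<theta>)\<^sup>2"
    using N by (simp add: \<gamma>_def power_divide power_mult_distrib field_simps)
  also have "\<dots> \<le> 160 * (1 + (real N * \<theta>)\<^sup>2)" by simp
  finally have le: "4 * (real N)\<^sup>2 * (cmod (1 - of_real \<gamma> * a))\<^sup>2 \<le> 160 * (1 + (real N * \<theta>)\<^sup>2)" .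
  have "(1 - \<gamma>)\<^sup>2 > 0" using gam by simp
  then have "(cmod (1 - of_real \<gamma> * a))\<^sup>2 > 0" unfolding eq using gam by (intro add_pos_nonneg) auto
  then have pos: "4 * (real N)\<^sup>2 * (cmod (1 - of_real \<gamma> * a))\<^sup>2 > 0" using N by simp
  have "160 / (160 * (1 + (real N * \<theta>)\<^sup>2)) \<le> 160 / (4 * (real N)\<^sup>2 * (cmod (1 - of_real \<gamma> * a))\<^sup>2)"
    by (intro frac_le le pos) auto
  moreover have "160 / (160 * (1 + (real N * \<theta>)\<^sup>2)) = 1 / (1 + (real N * \<theta>)\<^sup>2)"
    by (subst divide_divide_eq_left[symmetric]) simp
  ultimately show ?thesis unfolding \<gamma>_def[symmetric] \<theta>_def[symmetric] by simp
qed

section \<open>The tail bound\<close>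

lemma exp_mult_ln_le:
  fixes x t :: real
  assumes "x \<ge> 0" "0 \<le> t" "t \<le> 1"
  shows "exp (t * ln (1 + x)) \<le> 1 + x * t"
proof -
  have "exp ((1 - t) *\<^sub>R 0 + t *\<^sub>R ln (1 + x)) \<le> (1 - t) * exp 0 + t * exp (ln (1 + x))"
    using assms by (intro convex_onD[OF exp_convex]) auto
  also have "\<dots> = 1 + x * t" using assms by (simp add: algebra_simps)
  finally show ?thesis by simp
qed

lemma prod_list_one_plus_ge:
  fixes x :: real
  assumes "x \<ge> 0" "\<And>a. a \<in> set as \<Longrightarrow> 0 \<le> f a \<and> f a \<le> 1"
  shows "exp ((\<Sum>a\<leftarrow>as. f a) * ln (1 + x)) \<le> (\<Prod>a\<leftarrow>as. 1 + x * f a)"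
  using assms(2)
proof (induction as)
  case (Cons a as)
  have "exp ((f a + (\<Sum>a\<leftarrow>as. f a)) * ln (1 + x)) =
     exp (f a * ln (1 + x)) * exp ((\<Sum>a\<leftarrow>as. f a) * ln (1 + x))"
    by (simp add: distrib_right exp_add)
  also have "\<dots> \<le> (1 + x * f a) * (\<Prod>a\<leftarrow>as. 1 + x * f a)"
    using assms(1) Cons by (intro mult_mono exp_mult_ln_le) auto
  finally show ?case by simp
qed simp

text \<open>Each Gram ratio is integrated with weight 1 and \<open>I\<close> the complement of
  \<open>J\<close>. The resulting sum of \<open>(b * c) ^ (n - card J)\<close> over all subsets is
  the binomial expansion.\<close>

lemma haar_resolvent_product_le:
  assumes M: "haar_prob n M" and gam: "0 \<le> \<gamma>" "\<gamma> < 1" and b: "b \<ge> 0"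
  shows "(\<integral>\<^sup>+ g. ennreal (\<Sum>J\<in>Pow {0..<n}. b ^ (n - card J) * (row_gram n \<gamma> J g / row_gram n \<gamma> {0..<n} g)) \<partial>M)
    \<le> ennreal ((1 + b * (2 / (1 - \<gamma>\<^sup>2))) ^ n)"
proof -
  define c where "c = 2 / (1 - \<gamma>\<^sup>2)"
  have "\<gamma>\<^sup>2 < 1" using gam by (simp add: power_less_one_iff)
  then have c: "c > 0" by (simp add: c_def)
  interpret prob_space M using M by (simp add: haar_prob_def)
  let ?R = "\<lambda>J g. row_gram n \<gamma> J g / row_gram n \<gamma> {0..<n} g"
  note [measurable] = measurable_row_gram[OF M]
  have R0: "?R J g \<ge> 0" for J g by (simp add: row_gram_nonneg)
  have mult_ennreal: "ennreal (b ^ k) * ennreal (?R J g) = ennreal (b ^ k * ?R J g)" for k J g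
    using b R0 by (intro ennreal_mult[symmetric]) auto
  have "(\<integral>\<^sup>+ g. ennreal (\<Sum>J\<in>Pow {0..<n}. b ^ (n - card J) * ?R J g) \<partial>M) =
     (\<integral>\<^sup>+ g. (\<Sum>J\<in>Pow {0..<n}. ennreal (b ^ (n - card J)) * ennreal (?R J g)) \<partial>M)"
    unfolding mult_ennreal using b R0 by (intro nn_integral_cong, subst sum_ennreal)
      (auto intro!: mult_nonneg_nonneg simp del: times_divide_eq_right)
  also have "\<dots> = (\<Sum>J\<in>Pow {0..<n}. ennreal (b ^ (n - card J)) * (\<integral>\<^sup>+ g. ennreal (?R J g) \<partial>M))"
    by (simp add: nn_integral_sum nn_integral_cmult)
  also have "\<dots> \<le> (\<Sum>J\<in>Pow {0..<n}. ennreal (b ^ (n - card J)) * ennreal (c ^ (n - card J)))"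
  proof (intro sum_mono mult_left_mono)
    fix J assume J: "J \<in> Pow {0..<n}"
    then have "{0..<n} - ({0..<n} - J) = J" "card ({0..<n} - J) = n - card J"
      by (auto simp: card_Diff_subset finite_subset)
    then show "(\<integral>\<^sup>+ g. ennreal (?R J g) \<partial>M) \<le> ennreal (c ^ (n - card J))"
      using haar_row_gram_ratio_le[OF M gam, of "{0..<n} - J" "\<lambda>_. 1"]
      by (simp add: c_def emeasure_space_1)
  qed simp
  also have "\<dots> = ennreal (\<Sum>J\<in>Pow {0..<n}. (\<Prod>i\<in>J. 1) * (\<Prod>i\<in>{0..<n} - J. b * c))"
    using b c by (subst sum_ennreal[symmetric])
      (auto intro!: sum.cong simp: ennreal_mult'' power_mult_distrib card_Diff_subset finite_subset)
  also have "\<dots> = ennreal ((1 + b * c) ^ n)"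
    by (subst prod_add[symmetric]) auto
  finally show ?thesis by (simp add: c_def)
qed

lemma linear_stat_tail_le:
  assumes N: "N \<ge> 1" and M: "haar_prob N M" and x: "x \<ge> 0"
  shows "measure M {g \<in> space M. linear_stat N (\<lambda>\<xi>. 1 / (1 + \<xi>\<^sup>2)) g \<ge> x} \<le> exp (x - x / 3360 * ln (1 + x))"
proof (cases "{g \<in> space M. linear_stat N (\<lambda>\<xi>. 1 / (1 + \<xi>\<^sup>2)) g \<ge> x} \<in> sets M")
  \<comment> \<open>A set outside \<open>sets M\<close> has measure 0 by convention.\<close>
  case False
  then show ?thesis by (simp add: measure_notin_sets)
next
  case True
  define A where "A = {g \<in> space M. linear_stat N (\<lambda>\<xi>. 1 / (1 + \<xi>\<^sup>2)) g \<ge> x}"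
  have A [measurable]: "A \<in> sets M" using True by (simp add: A_def)
  define \<gamma> where "\<gamma> = 1 - 1 / (2 * real N)"
  have gam: "0 < \<gamma>" "\<gamma> < 1" using N by (auto simp: \<gamma>_def field_simps)
  define b where "b = x / (4 * (real N)\<^sup>2)"
  define \<Phi> where "\<Phi> g = (\<Sum>J\<in>Pow {0..<N}. b ^ (N - card J) * (row_gram N \<gamma> J g / row_gram N \<gamma> {0..<N} g))" for g
  interpret prob_space M using M by (simp add: haar_prob_def)
  have ge: "exp (x / 3360 * ln (1 + x)) \<le> \<Phi> g" if "g \<in> A" for g
  proof -
    have g: "g \<in> unitary_group N" and gx: "x \<le> linear_stat N (\<lambda>\<xi>. 1 / (1 + \<xi>\<^sup>2)) g"
      using that space_haar_prob[OF M] by (auto simp: A_def)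
    obtain as where as: "char_poly g = (\<Prod>a\<leftarrow>as. [:- a, 1:])" "length as = N"
      using char_poly_factorized[OF unitary_group_carrier[OF g]] by blast
    have n1: "cmod a = 1" if "a \<in> set as" for a
    proof (rule unitary_eigenvalue_norm[OF g])
      show "poly (char_poly g) a = 0"
        unfolding as using that by (auto simp: poly_prod_list o_def prod_list_zero_iff)
    qed
    define f where "f a = 1 / (4 * (real N)\<^sup>2) / (cmod (1 - of_real \<gamma> * a))\<^sup>2" for a
    have f: "0 \<le> f a \<and> f a \<le> 1" if "a \<in> set as" for a
    proof -
      \<comment> \<open>With \<open>1 - \<gamma> = 1 / (2N)\<close> the normalization by
        \<open>4 N^2\<close> makes \<open>f a \<le> 1\<close>, as Bernoulli's inequality
        requires.\<close>
      have "1 - \<gamma> \<le> cmod (1 - of_real \<gamma> * a)"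
        using norm_triangle_ineq2[of 1 "of_real \<gamma> * a"] n1[OF that] gam by (simp add: norm_mult)
      then have "(1 - \<gamma>)\<^sup>2 \<le> (cmod (1 - of_real \<gamma> * a))\<^sup>2"
        using gam by (intro power_mono) auto
      then have "1 / (4 * (real N)\<^sup>2) \<le> (cmod (1 - of_real \<gamma> * a))\<^sup>2"
        by (simp add: \<gamma>_def power_divide power_mult_distrib)
      then show ?thesis unfolding f_def by (intro conjI divide_le_eq_1[THEN iffD2]) auto
    qed
    have "x \<le> (\<Sum>a\<leftarrow>as. 21 / (1 + (real N * eigenangle a)\<^sup>2))"
      using gx linear_stat_cauchy_le[OF N as(1) n1] by linarith
    \<comment> \<open>Here 3360 = 21 * 160, from the periodization and the comparison with the
      resolvent.\<close>
    also have "\<dots> \<le> (\<Sum>a\<leftarrow>as. 3360 * f a)"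
    proof (intro sum_list_mono)
      fix a assume "a \<in> set as"
      then show "21 / (1 + (real N * eigenangle a)\<^sup>2) \<le> 3360 * f a"
        using cauchy_le_resolvent[OF N n1, of a] by (simp add: f_def \<gamma>_def)
    qed
    also have "\<dots> = 3360 * (\<Sum>a\<leftarrow>as. f a)" by (simp add: sum_list_const_mult)
    finally have "x / 3360 * ln (1 + x) \<le> (\<Sum>a\<leftarrow>as. f a) * ln (1 + x)"
      using x by (intro mult_right_mono) auto
    then have "exp (x / 3360 * ln (1 + x)) \<le> exp ((\<Sum>a\<leftarrow>as. f a) * ln (1 + x))" by simp
    also have "\<dots> \<le> (\<Prod>a\<leftarrow>as. 1 + x * f a)" using x f by (rule prod_list_one_plus_ge)
    also have "\<dots> = (\<Prod>a\<leftarrow>as. 1 + b / (cmod (1 - of_real \<gamma> * a))\<^sup>2)" by (simp add: f_def b_def)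
    also have "\<dots> = \<Phi> g" unfolding \<Phi>_def by (rule prod_list_resolvent_eq_sum_row_gram[OF g as gam])
    finally show ?thesis .
  qed
  \<comment> \<open>Markov's inequality for the majorant \<open>\<Phi>\<close>, carried out on
    \<open>A\<close>.\<close>
  have "ennreal (exp (x / 3360 * ln (1 + x))) * emeasure M A =
     (\<integral>\<^sup>+ g. ennreal (exp (x / 3360 * ln (1 + x))) * indicator A g \<partial>M)"
    by (simp add: nn_integral_cmult_indicator)
  also have "\<dots> \<le> (\<integral>\<^sup>+ g. ennreal (\<Phi> g) \<partial>M)"
    using ge by (intro nn_integral_mono) (auto simp: indicator_def intro!: ennreal_leI)
  also have "\<dots> \<le> ennreal ((1 + b * (2 / (1 - \<gamma>\<^sup>2))) ^ N)"
    unfolding \<Phi>_def using x gam by (intro haar_resolvent_product_le[OF M]) (auto simp: b_def)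
  also have "\<dots> \<le> ennreal (exp x)"
  proof (intro ennreal_leI)
    \<comment> \<open>Since \<open>1 - \<gamma>\<^sup>2\<close> is at least \<open>1 / (2N)\<close>,
      each row costs at most \<open>4N\<close>, and \<open>b * 4N = x / N\<close>.\<close>
    have "\<gamma>\<^sup>2 \<le> \<gamma>" using gam by (simp add: power2_eq_square mult_left_le_one_le)
    then have "1 / (2 * real N) \<le> 1 - \<gamma>\<^sup>2" by (simp add: \<gamma>_def)
    then have "2 / (1 - \<gamma>\<^sup>2) \<le> 2 / (1 / (2 * real N))"
      using N by (intro frac_le) auto
    then have "b * (2 / (1 - \<gamma>\<^sup>2)) \<le> b * (4 * real N)"
      using x by (intro mult_left_mono) (auto simp: b_def)
    also have "\<dots> = x / real N" using N by (simp add: b_def power2_eq_square)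
    finally have "(1 + b * (2 / (1 - \<gamma>\<^sup>2))) ^ N \<le> (1 + x / real N) ^ N"
      using x gam by (intro power_mono add_nonneg_nonneg mult_nonneg_nonneg divide_nonneg_nonneg)
        (auto simp: b_def power_le_one)
    also have "\<dots> \<le> exp x"
      using x N by (intro exp_ge_one_plus_x_over_n_power_n) auto
    finally show "(1 + b * (2 / (1 - \<gamma>\<^sup>2))) ^ N \<le> exp x" .
  qed
  finally have "ennreal (exp (x / 3360 * ln (1 + x)) * measure M A) \<le> ennreal (exp x)"
    by (simp add: emeasure_eq_measure ennreal_mult'')
  then have "exp (x / 3360 * ln (1 + x)) * measure M A \<le> exp x" by (simp add: ennreal_le_iff)
  then have "measure M A \<le> exp (x - x / 3360 * ln (1 + x))"
    unfolding exp_diff by (simp add: pos_le_divide_eq mult.commute)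
  then show ?thesis by (simp add: A_def)
qed

theorem theorem4p5:
  shows "\<exists>C > 0. \<exists>K > 0. \<forall>N \<ge> (1::nat). \<forall>M. haar_prob N M \<longrightarrow>
    (\<forall>x \<ge> (2::real).
      measure M {g \<in> space M. linear_stat N (\<lambda>\<xi>. 1 / (1 + \<xi>\<^sup>2)) g \<ge> x}
        \<le> K * exp (- C * x * ln x))"
proof (rule exI[of _ "1/6720"], rule conjI, simp, rule exI[of _ "exp (exp 6720)"], intro conjI allI impI)
  fix N :: nat and M :: "complex mat measure" and x :: real
  assume N: "1 \<le> N" and M: "haar_prob N M" and x: "2 \<le> x"
  have "x * ln x \<le> x * ln (1 + x)" using x by (intro mult_left_mono) auto
  \<comment> \<open>Half of the rate 1/3360 is kept as \<open>C\<close>. The other half absorbs the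
    term \<open>x\<close> once \<open>ln x\<close> exceeds 6720; below that, \<open>x\<close> is at
    most \<open>exp 6720\<close>, which goes into \<open>K\<close>.\<close>
  moreover have "x - x * ln x / 6720 \<le> exp 6720"
  proof (cases "x \<le> exp 6720")
    case True
    moreover have "x * ln x / 6720 \<ge> 0" using x by simp
    ultimately show ?thesis by linarith
  next
    case False
    then have "ln (exp 6720) \<le> ln x" using x by (subst ln_le_cancel_iff) auto
    then have "6720 \<le> ln x" by simp
    then have "x * 6720 \<le> x * ln x" using x by (intro mult_left_mono) auto
    then have "x - x * ln x / 6720 \<le> 0" by simp
    also have "0 \<le> exp (6720 :: real)" by simp
    finally show ?thesis .
  qed
  ultimately have "x - x / 3360 * ln (1 + x) \<le> exp 6720 + (- (1/6720) * x * ln x)" by simp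
  then have "exp (x - x / 3360 * ln (1 + x)) \<le> exp (exp 6720 + (- (1/6720) * x * ln x))"
    by (simp only: exp_le_cancel_iff)
  also have "\<dots> = exp (exp 6720) * exp (- (1/6720) * x * ln x)" by (rule exp_add)
  finally show "measure M {g \<in> space M. linear_stat N (\<lambda>\<xi>. 1 / (1 + \<xi>\<^sup>2)) g \<ge> x}
     \<le> exp (exp 6720) * exp (- (1/6720) * x * ln x)"
    using linear_stat_tail_le[OF N M, of x] x by linarith
qed auto

end
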